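(* Let $H$ be a complex Hilbert space and let $S,T$ be positive trace class operators on $H$. Let $f_S,f_T$ be the positive functionals on $B(H)$ given by $f_S(A)=\operatorname{Tr}(AS)$ and $f_T(A)=\operatorname{Tr}(AT)$ for $A\in B(H)$. (a) The operators $S$ and $T$ are mutually singular if and only if the functionals $f_S$ and $f_T$ are mutually singular. (b) The operator $S$ is absolutely continuous with respect to $T$ if and only if the functional $f_S$ is almost dominated by $f_T$.
   Context: $B(H)$ is the $C^*$-algebra of all continuous linear operators on $H$. A linear functional $f$ on $B(H)$ is positive if $f(A^*A)\ge 0$ for all $A\in B(H)$; for positive functionals, $h\le f$ means $h(A^*A)\le f(A^*A)$ for all $A\in B(H)$. For positive operators, $\le$ is the usual (Loewner) order. Notions for positive operators $S,T\in B(H)$: - $S$ is absolutely continuous with respect to $T$ if there is a monotone increasing sequence $(S_n)$ of positive operators in $B(H)$ such that for each $n$ there is $c_n\ge 0$ with $S_n\le c_nT$, and $S_n\to S$ in the strong operator topology. - $S$ and $T$ are (mutually) singular if for every positive operator $R\in B(H)$, $R\le S$ and $R\le T$ imply $R=0$. Notions for positive functionals $f,g$ on $B(H)$: - $g$ is almost dominated by $f$ if there are positive functionals $g_n$ on $B(H)$ and constants $c_n\ge 0$ with $g_n\le g_{n+1}\le g$ and $g_n\le c_n f$ for all $n$, and $g_n(A)\to g(A)$ for all $A\in B(H)$. - $f$ and $g$ are mutually singular if for every positive functional $h$ on $B(H)$ (not assumed normal), $h\le f$ and $h\le g$ imply $h=0$. *)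

theory Defs
  imports "HOL-Analysis.Analysis"
begin

(* Complex Hilbert spaces. The inner product is linear in the first argument; positive
   definiteness is contained in cinner_self, and completeness in banach. *)
class chilbert_space = banach +
  fixes scaleC :: "complex \<Rightarrow> 'a \<Rightarrow> 'a"  (infixr \<open>*\<^sub>C\<close> 75)
    and cinner :: "'a \<Rightarrow> 'a \<Rightarrow> complex"
  assumes scaleC_add_right: "a *\<^sub>C (x + y) = a *\<^sub>C x + a *\<^sub>C y"
    and scaleC_add_left: "(a + b) *\<^sub>C x = a *\<^sub>C x + b *\<^sub>C x"
    and scaleC_scaleC: "a *\<^sub>C b *\<^sub>C x = (a * b) *\<^sub>C x"
    and scaleR_scaleC: "r *\<^sub>R x = complex_of_real r *\<^sub>C x"
    and cinner_add_left: "cinner (x + y) z = cinner x z + cinner y z"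
    and cinner_scaleC_left: "cinner (a *\<^sub>C x) y = a * cinner x y"
    and cinner_commute: "cinner x y = cnj (cinner y x)"
    and cinner_self: "cinner x x = complex_of_real ((norm x)\<^sup>2)"

global_interpretation complex_vector:
  vector_space "scaleC :: complex \<Rightarrow> 'a::chilbert_space \<Rightarrow> 'a"
proof
  show "1 *\<^sub>C x = x" for x :: 'a
    using scaleR_scaleC[of 1 x] by simp
qed (simp_all add: scaleC_add_right scaleC_add_left scaleC_scaleC)

instantiation complex :: chilbert_space
begin

definition scaleC_complex :: "complex \<Rightarrow> complex \<Rightarrow> complex"
  where "scaleC_complex a x = a * x"

definition cinner_complex :: "complex \<Rightarrow> complex \<Rightarrow> complex"
  where "cinner_complex x y = x * cnj y"

instance
  by standard
    (simp_all add: scaleC_complex_def cinner_complex_def algebra_simps scaleR_conv_of_real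
      complex_norm_square flip: of_real_power)

end

definition is_onb :: "'a::chilbert_space set \<Rightarrow> bool"
  where "is_onb E \<longleftrightarrow>
    (\<forall>e\<in>E. \<forall>f\<in>E. cinner e f = (if e = f then 1 else 0)) \<and>
    closure (complex_vector.span E) = UNIV"

(* Membership in B(H). Operators are plain functions, functionals on B(H) are functions
   on ('a => 'a) whose values outside B(H) are irrelevant. *)
definition bounded_clinear :: "('a::chilbert_space \<Rightarrow> 'a) \<Rightarrow> bool"
  where "bounded_clinear A \<longleftrightarrow> bounded_linear A \<and> (\<forall>c x. A (c *\<^sub>C x) = c *\<^sub>C A x)"

definition cadjoint :: "('a::chilbert_space \<Rightarrow> 'a) \<Rightarrow> 'a \<Rightarrow> 'a"
  where "cadjoint A =
    (THE B. bounded_clinear B \<and> (\<forall>x y. cinner (A x) y = cinner x (B y)))"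

(* On complex numbers, x \<le> y means Re x \<le> Re y and Im x = Im y (HOL-Library.Complex_Order);
   in particular 0 \<le> z says that z is real and nonnegative. *)
definition positive_op :: "('a::chilbert_space \<Rightarrow> 'a) \<Rightarrow> bool"
  where "positive_op A \<longleftrightarrow> bounded_clinear A \<and> (\<forall>x. 0 \<le> cinner (A x) x)"

definition op_le :: "('a::chilbert_space \<Rightarrow> 'a) \<Rightarrow> ('a \<Rightarrow> 'a) \<Rightarrow> bool"
  where "op_le A B \<longleftrightarrow> positive_op (\<lambda>x. B x - A x)"

(* R is the modulus of A, the unique positive square root of A*A. *)
definition trace_class :: "('a::chilbert_space \<Rightarrow> 'a) \<Rightarrow> bool"
  where "trace_class A \<longleftrightarrow> bounded_clinear A \<and>
    (\<exists>R E. positive_op R \<and> R \<circ> R = cadjoint A \<circ> A \<and>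
      is_onb E \<and> (\<lambda>e. cinner (R e) e) summable_on E)"

(* The trace of a trace class operator does not depend on the orthonormal basis. *)
definition trace :: "('a::chilbert_space \<Rightarrow> 'a) \<Rightarrow> complex"
  where "trace A = (\<Sum>\<^sub>\<infinity>e\<in>(SOME E. is_onb E). cinner (A e) e)"

definition op_abs_continuous :: "('a::chilbert_space \<Rightarrow> 'a) \<Rightarrow> ('a \<Rightarrow> 'a) \<Rightarrow> bool"
  where "op_abs_continuous S T \<longleftrightarrow>
    (\<exists>Sn :: nat \<Rightarrow> 'a \<Rightarrow> 'a.
      (\<forall>n. positive_op (Sn n)) \<and>
      (\<forall>n. op_le (Sn n) (Sn (Suc n))) \<and>
      (\<forall>n. \<exists>c\<ge>0. op_le (Sn n) (\<lambda>x. c *\<^sub>R T x)) \<and>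
      (\<forall>x. (\<lambda>n. Sn n x) \<longlonglongrightarrow> S x))"

definition op_singular :: "('a::chilbert_space \<Rightarrow> 'a) \<Rightarrow> ('a \<Rightarrow> 'a) \<Rightarrow> bool"
  where "op_singular S T \<longleftrightarrow>
    (\<forall>R. positive_op R \<longrightarrow> op_le R S \<longrightarrow> op_le R T \<longrightarrow> R = (\<lambda>x. 0))"

definition positive_functional :: "(('a::chilbert_space \<Rightarrow> 'a) \<Rightarrow> complex) \<Rightarrow> bool"
  where "positive_functional f \<longleftrightarrow>
    (\<forall>A B. bounded_clinear A \<longrightarrow> bounded_clinear B \<longrightarrow> f (\<lambda>x. A x + B x) = f A + f B) \<and>
    (\<forall>c A. bounded_clinear A \<longrightarrow> f (\<lambda>x. c *\<^sub>C A x) = c * f A) \<and>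
    (\<forall>A. bounded_clinear A \<longrightarrow> 0 \<le> f (cadjoint A \<circ> A))"

definition functional_le ::
    "(('a::chilbert_space \<Rightarrow> 'a) \<Rightarrow> complex) \<Rightarrow> (('a \<Rightarrow> 'a) \<Rightarrow> complex) \<Rightarrow> bool"
  where "functional_le h f \<longleftrightarrow>
    (\<forall>A. bounded_clinear A \<longrightarrow> h (cadjoint A \<circ> A) \<le> f (cadjoint A \<circ> A))"

definition almost_dominated ::
    "(('a::chilbert_space \<Rightarrow> 'a) \<Rightarrow> complex) \<Rightarrow> (('a \<Rightarrow> 'a) \<Rightarrow> complex) \<Rightarrow> bool"
  where "almost_dominated g f \<longleftrightarrow>
    (\<exists>(gn :: nat \<Rightarrow> ('a \<Rightarrow> 'a) \<Rightarrow> complex) (c :: nat \<Rightarrow> real).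
      (\<forall>n. positive_functional (gn n)) \<and>
      (\<forall>n. c n \<ge> 0) \<and>
      (\<forall>n. functional_le (gn n) (gn (Suc n))) \<and>
      (\<forall>n. functional_le (gn n) g) \<and>
      (\<forall>n. functional_le (gn n) (\<lambda>A. complex_of_real (c n) * f A)) \<and>
      (\<forall>A. bounded_clinear A \<longrightarrow> (\<lambda>n. gn n A) \<longlonglongrightarrow> g A))"

definition functional_singular ::
    "(('a::chilbert_space \<Rightarrow> 'a) \<Rightarrow> complex) \<Rightarrow> (('a \<Rightarrow> 'a) \<Rightarrow> complex) \<Rightarrow> bool"
  where "functional_singular f g \<longleftrightarrow>
    (\<forall>h. positive_functional h \<longrightarrow> functional_le h f \<longrightarrow> functional_le h g \<longrightarrow>
      (\<forall>A. bounded_clinear A \<longrightarrow> h A = 0))"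

definition trace_functional :: "('a::chilbert_space \<Rightarrow> 'a) \<Rightarrow> ('a \<Rightarrow> 'a) \<Rightarrow> complex"
  where "trace_functional S A = trace (A \<circ> S)"

end

theory Submission
  imports Defs
begin

text \<open>A positive functional \<open>h\<close> below \<open>f\<^sub>S\<close> has a density: the form \<open>(x, y) \<mapsto> h(x \<otimes> y)\<close> on rank one
  operators is represented by an operator \<open>R\<close> with \<open>0 \<le> R \<le> S\<close>. If \<open>R = 0\<close>, then \<open>h\<close> vanishes on
  finite rank projections, so \<open>h(1) \<le> Tr S - \<Sum>\<^sub>F \<langle>S e, e\<rangle>\<close> for every finite part \<open>F\<close> of a basis,
  hence \<open>h = 0\<close>, even if \<open>h\<close> is not assumed normal. In the other direction \<open>R \<mapsto> f\<^sub>R\<close> preserves the order,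
  and \<open>\<bar>f\<^sub>P A\<bar> \<le> \<parallel>A\<parallel> Tr P\<close> turns strong convergence of \<open>S\<^sub>n \<up> S\<close> into pointwise convergence of
  the functionals. Strong convergence of the densities follows from that of their quadratic forms,
  since \<open>\<parallel>D x\<parallel>\<^sup>2 \<le> K \<langle>D x, x\<rangle>\<close> for \<open>0 \<le> D \<le> K\<close>.\<close>

section \<open>Inner products and positive forms\<close>

text \<open>A discriminant argument: choosing \<open>c\<close> as a real multiple of
  \<open>cnj b\<close> leaves a real quadratic in \<open>t\<close>. It serves twice, for the
  Cauchy-Schwarz inequality and, with \<open>a = 0\<close>, as the variational equation in the Riesz
  representation.\<close>

lemma quadratic_nonneg_imp_le:
  fixes a d :: real and b :: complex
  assumes ge: "\<And>c. 0 \<le> a + 2 * Re (c * b) + (cmod c)\<^sup>2 * d" and "0 \<le> d"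
  shows "(cmod b)\<^sup>2 \<le> a * d"
proof -
  have sq: "b * cnj b = complex_of_real ((cmod b)\<^sup>2)"
    by (simp add: complex_norm_square flip: of_real_power)
  have *: "0 \<le> a - 2 * t * (cmod b)\<^sup>2 + t\<^sup>2 * (cmod b)\<^sup>2 * d" for t :: real
  proof -
    have "(- complex_of_real t * cnj b) * b = complex_of_real (- t * (cmod b)\<^sup>2)"
      using sq by (simp add: mult.commute mult.left_commute)
    then have "Re ((- complex_of_real t * cnj b) * b) = - t * (cmod b)\<^sup>2"
      by (metis Re_complex_of_real)
    moreover have "(cmod (- complex_of_real t * cnj b))\<^sup>2 = t\<^sup>2 * (cmod b)\<^sup>2"
      by (simp add: norm_mult power_mult_distrib)
    ultimately show ?thesis
      using ge[of "- complex_of_real t * cnj b"] by simp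
  qed
  show ?thesis
  proof (cases "d = 0")
    case True
    have "b = 0"
    proof (rule ccontr)
      assume "b \<noteq> 0"
      then have "(cmod b)\<^sup>2 > 0" by simp
      \<comment> \<open>With \<open>d = 0\<close> the expression is affine in \<open>t\<close>, and
        this is the \<open>t\<close> at which it equals \<open>- 1\<close>.\<close>
      then have "a - 2 * ((a + 1) / (2 * (cmod b)\<^sup>2)) * (cmod b)\<^sup>2 = - 1"
        by (simp add: field_simps)
      with *[of "(a + 1) / (2 * (cmod b)\<^sup>2)"] True show False by simp
    qed
    with True show ?thesis by simp
  next
    case False
    with \<open>0 \<le> d\<close> have "d > 0" by simp
    \<comment> \<open>\<open>1 / d\<close> is the minimiser of the quadratic in
      \<open>t\<close>.\<close>
    have "a - 2 * (1 / d) * (cmod b)\<^sup>2 + (1 / d)\<^sup>2 * (cmod b)\<^sup>2 * d = a - (cmod b)\<^sup>2 / d"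
      using \<open>d > 0\<close> by (simp add: field_simps power2_eq_square)
    with *[of "1 / d"] have "(cmod b)\<^sup>2 / d \<le> a" by simp
    with \<open>d > 0\<close> show ?thesis by (simp add: field_simps)
  qed
qed

locale sesquilinear =
  fixes q :: "'a::chilbert_space \<Rightarrow> 'a \<Rightarrow> complex"
  assumes add_left: "q (x + y) z = q x z + q y z"
    and add_right: "q x (y + z) = q x y + q x z"
    and scale_left: "q (c *\<^sub>C x) y = c * q x y"
    and scale_right: "q x (c *\<^sub>C y) = cnj c * q x y"

text \<open>Positive semidefinite forms, instantiated with \<open>cinner\<close>, with
  \<open>cinner (P x) y\<close> for a positive operator \<open>P\<close>, and with
  \<open>h (rank_one x y)\<close> for a positive functional \<open>h\<close>.\<close>

locale positive_form = sesquilinear +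
  assumes nonneg: "0 \<le> q x x"
begin

text \<open>Polarisation over the complex scalars: a real diagonal at \<open>x + y\<close> ties the
  imaginary parts together, at \<open>\<i> *\<^sub>C x + y\<close> the real parts.\<close>

lemma hermitian: "q y x = cnj (q x y)"
proof -
  have re: "Im (q z z) = 0" for z
    using nonneg[of z] by (simp add: less_eq_complex_def)
  have "Im (q x y) + Im (q y x) = 0"
    using re[of "x + y"] re[of x] re[of y] by (simp add: add_left add_right)
  moreover have "Re (q x y) - Re (q y x) = 0"
    using re[of "\<i> *\<^sub>C x + y"] re[of x] re[of y]
    by (simp add: add_left add_right scale_left scale_right)
  ultimately show ?thesis by (simp add: complex_eq_iff)
qed

lemma Cauchy_Schwarz: "(cmod (q x y))\<^sup>2 \<le> Re (q x x) * Re (q y y)"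
proof -
  have "0 \<le> Re (q x x) + 2 * Re (c * q y x) + (cmod c)\<^sup>2 * Re (q y y)" for c
  proof -
    have "q (x + c *\<^sub>C y) (x + c *\<^sub>C y) =
        q x x + (c * q y x + cnj (c * q y x)) + (c * cnj c) * q y y"
      by (simp add: add_left add_right scale_left scale_right hermitian[of y x] algebra_simps)
    moreover have "Re ((c * cnj c) * q y y) = (cmod c)\<^sup>2 * Re (q y y)"
      by (simp only: complex_norm_square[symmetric] Re_complex_of_real) simp
    ultimately have "Re (q (x + c *\<^sub>C y) (x + c *\<^sub>C y)) =
        Re (q x x) + 2 * Re (c * q y x) + (cmod c)\<^sup>2 * Re (q y y)" by simp
    with nonneg[of "x + c *\<^sub>C y"] show ?thesis by (simp add: less_eq_complex_def)
  qed
  moreover have "0 \<le> Re (q y y)" using nonneg[of y] by (simp add: less_eq_complex_def)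
  ultimately have "(cmod (q y x))\<^sup>2 \<le> Re (q x x) * Re (q y y)"
    by (rule quadratic_nonneg_imp_le)
  then show ?thesis by (simp add: hermitian[of y x])
qed

end

lemma scaleC_minus1: "(- 1) *\<^sub>C x = - (x::'a::chilbert_space)"
  using complex_vector.scale_minus_left[of 1 x] complex_vector.scale_one[of x] by simp

lemma positive_form_cinner: "positive_form (cinner :: 'a::chilbert_space \<Rightarrow> _)"
proof
  show "cinner x (y + z) = cinner x y + cinner x z" for x y z :: 'a
    by (metis cinner_commute cinner_add_left complex_cnj_add)
  show "cinner x (c *\<^sub>C y) = cnj c * cinner x y" for x y :: 'a and c
    by (metis cinner_commute cinner_scaleC_left complex_cnj_mult)
qed (simp_all add: cinner_add_left cinner_scaleC_left cinner_self less_eq_complex_def)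

interpretation cinner: positive_form cinner
  by (rule positive_form_cinner)

context sesquilinear begin

lemma minus_left: "q (- x) y = - q x y"
  using scale_left[of "-1" x y] by (simp add: scaleC_minus1)

lemma minus_right: "q x (- y) = - q x y"
  using scale_right[of x "-1" y] by (simp add: scaleC_minus1)

lemma diff_left: "q (x - y) z = q x z - q y z"
  using add_left[of x "- y" z] by (simp add: minus_left)

lemma diff_right: "q x (y - z) = q x y - q x z"
  using add_right[of x y "- z"] by (simp add: minus_right)

lemma zero_left: "q 0 y = 0"
  using diff_left[of 0 0 y] by simp

lemma zero_right: "q x 0 = 0"
  using diff_right[of x 0 0] by simp

lemma sum_left: "q (sum f F) y = (\<Sum>i\<in>F. q (f i) y)"
  by (induction F rule: infinite_finite_induct) (simp_all add: zero_left add_left)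

lemma sum_right: "q x (sum f F) = (\<Sum>i\<in>F. q x (f i))"
  by (induction F rule: infinite_finite_induct) (simp_all add: zero_right add_right)

end

lemmas cinner_simps = cinner.add_left cinner.add_right cinner.scale_left cinner.scale_right
  cinner.minus_left cinner.minus_right cinner.diff_left cinner.diff_right
  cinner.zero_left cinner.zero_right

lemma norm_cinner_le: "cmod (cinner x y) \<le> norm x * norm (y::'a::chilbert_space)"
proof (rule power2_le_imp_le)
  show "(cmod (cinner x y))\<^sup>2 \<le> (norm x * norm y)\<^sup>2"
    using cinner.Cauchy_Schwarz[of x y] by (simp add: cinner_self power_mult_distrib)
qed simp

lemma norm_scaleC: "norm (c *\<^sub>C x) = cmod c * norm (x::'a::chilbert_space)"
proof -
  have "complex_of_real ((norm (c *\<^sub>C x))\<^sup>2) = (c * cnj c) * cinner x x"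
    by (simp only: cinner_self[symmetric] cinner_simps) simp
  also have "\<dots> = complex_of_real ((cmod c * norm x)\<^sup>2)"
    by (simp add: cinner_self complex_norm_square[symmetric] power_mult_distrib)
  finally have "(norm (c *\<^sub>C x))\<^sup>2 = (cmod c * norm x)\<^sup>2" by (simp only: of_real_eq_iff)
  then show ?thesis by (simp add: power2_eq_iff_nonneg)
qed

lemma Re_cinner_self: "Re (cinner x x) = (norm (x::'a::chilbert_space))\<^sup>2"
  by (simp add: cinner_self)

lemma bounded_bilinear_cinner: "bounded_bilinear (cinner :: 'a::chilbert_space \<Rightarrow> _)"
proof
  show "\<exists>K. \<forall>a b::'a. norm (cinner a b) \<le> norm a * norm b * K"
    using norm_cinner_le by (intro exI[of _ 1]) auto
qed (simp_all add: cinner_simps scaleR_scaleC scaleC_complex_def)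

lemmas tendsto_cinner = bounded_bilinear.tendsto[OF bounded_bilinear_cinner]

lemma norm_add_sq:
  "(norm (x + y))\<^sup>2 = (norm x)\<^sup>2 + 2 * Re (cinner y x) + (norm (y::'a::chilbert_space))\<^sup>2"
proof -
  have "Re (cinner x y) = Re (cinner y x)" by (subst cinner_commute) simp
  then show ?thesis by (simp add: Re_cinner_self[symmetric] cinner_simps)
qed

lemma cinner_eqI:
  assumes "\<And>z. cinner x z = cinner y (z::'a::chilbert_space)"
  shows "x = y"
proof -
  have "cinner (x - y) (x - y) = 0" by (simp only: cinner.diff_left assms) simp
  then show ?thesis by (simp add: cinner_self)
qed

lemma cinner_eqI_right:
  assumes "\<And>z. cinner z x = cinner z (y::'a::chilbert_space)"
  shows "x = y"
proof (rule cinner_eqI)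
  show "cinner x z = cinner y z" for z
    by (simp only: cinner_commute[of x z] cinner_commute[of y z] assms)
qed

section \<open>Riesz representation and adjoints\<close>

text \<open>The representing vector minimises \<open>\<parallel>x\<parallel>\<^sup>2 - 2 Re (\<phi> x)\<close>, so that neither orthogonal
  projections nor the kernel of \<open>\<phi>\<close> are needed.\<close>

lemma Riesz_representation:
  fixes \<phi> :: "'a::chilbert_space \<Rightarrow> complex"
  assumes add: "\<And>x y. \<phi> (x + y) = \<phi> x + \<phi> y"
    and scale: "\<And>c x. \<phi> (c *\<^sub>C x) = c * \<phi> x"
    and bound: "\<And>x. cmod (\<phi> x) \<le> K * norm x"
  shows "\<exists>y. \<forall>x. \<phi> x = cinner x y"
proof -
  define J where "J x = (norm x)\<^sup>2 - 2 * Re (\<phi> x)" for x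
  \<comment> \<open>Completing the square: \<open>J x\<close> is at least
    \<open>(norm x - K)\<^sup>2 - K\<^sup>2\<close>.\<close>
  have lower: "- K\<^sup>2 \<le> J x" for x
  proof -
    have "Re (\<phi> x) \<le> K * norm x" using complex_Re_le_cmod[of "\<phi> x"] bound[of x] by simp
    moreover have "0 \<le> (norm x - K)\<^sup>2" by simp
    ultimately show ?thesis by (simp add: J_def power2_diff mult.commute)
  qed
  define m where "m = (INF x. J x)"
  have bdd: "bdd_below (range J)" using lower by (intro bdd_belowI2)
  have m_le: "m \<le> J x" for x unfolding m_def by (rule cINF_lower[OF bdd]) simp
  define \<epsilon> where "\<epsilon> n = inverse (real (Suc n))" for n
  have "\<exists>x. J x < m + \<epsilon> n" for n
    using cINF_less_iff[OF UNIV_not_empty bdd, of "m + \<epsilon> n"]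
    unfolding m_def by (simp add: \<epsilon>_def)
  then obtain u where u: "\<And>n. J (u n) < m + \<epsilon> n" by metis
  \<comment> \<open>The parallelogram law together with \<open>m \<le> J\<close> at the midpoint of
    \<open>v\<close> and \<open>w\<close>: two near-minimisers are close to each other, so a
    minimising sequence is Cauchy.\<close>
  have par: "(norm (v - w))\<^sup>2 \<le> 2 * (J v + J w - 2 * m)" for v w
  proof -
    let ?h = "complex_of_real (1/2)"
    have "\<phi> (?h *\<^sub>C (v + w)) = ?h * (\<phi> v + \<phi> w)" by (simp only: scale add)
    then have "Re (\<phi> (?h *\<^sub>C (v + w))) = Re (?h * (\<phi> v + \<phi> w))" by (simp only:)
    also have "\<dots> = (Re (\<phi> v) + Re (\<phi> w)) / 2"
      by (simp only: Re_complex_of_real Im_complex_of_real times_complex.sel) simp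
    finally have "Re (\<phi> (?h *\<^sub>C (v + w))) = (Re (\<phi> v) + Re (\<phi> w)) / 2" .
    then have "J (?h *\<^sub>C (v + w)) = (norm (v + w))\<^sup>2 / 4 - (Re (\<phi> v) + Re (\<phi> w))"
      by (simp add: J_def norm_scaleC power_mult_distrib power_divide)
    moreover have "(norm (v + w))\<^sup>2 + (norm (v - w))\<^sup>2 = 2 * (norm v)\<^sup>2 + 2 * (norm w)\<^sup>2"
      using norm_add_sq[of v w] norm_add_sq[of v "- w"] by (simp add: cinner_simps)
    ultimately show ?thesis using m_le[of "?h *\<^sub>C (v + w)"] by (simp add: J_def)
  qed
  have "Cauchy u"
  proof (rule metric_CauchyI)
    fix e :: real assume "0 < e"
    then obtain N where N: "\<epsilon> N < e\<^sup>2 / 4"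
      unfolding \<epsilon>_def using reals_Archimedean[of "e\<^sup>2 / 4"] by auto
    have "dist (u i) (u j) < e" if "N \<le> i" "N \<le> j" for i j
    proof -
      have "\<epsilon> i \<le> \<epsilon> N" "\<epsilon> j \<le> \<epsilon> N"
        using that by (auto simp: \<epsilon>_def intro: le_imp_inverse_le)
      moreover have "4 * \<epsilon> N < e\<^sup>2" using N by simp
      ultimately have "2 * (J (u i) + J (u j) - 2 * m) < e\<^sup>2" using u[of i] u[of j] by argo
      with par[of "u i" "u j"] have "(norm (u i - u j))\<^sup>2 < e\<^sup>2" by linarith
      with \<open>0 < e\<close> show ?thesis by (simp add: dist_norm power_less_imp_less_base)
    qed
    then show "\<exists>M. \<forall>i\<ge>M. \<forall>j\<ge>M. dist (u i) (u j) < e" by blast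
  qed
  then obtain y where y: "u \<longlonglongrightarrow> y" using Cauchy_convergent convergent_def by blast
  have "bounded_linear \<phi>"
  proof (rule bounded_linear_intro)
    show "\<phi> (r *\<^sub>R x) = r *\<^sub>R \<phi> x" for r x by (simp add: scaleR_scaleC scale scaleC_complex_def)
    show "norm (\<phi> x) \<le> norm x * K" for x using bound[of x] by (simp add: mult.commute)
  qed (rule add)
  from bounded_linear.tendsto[OF this y] have "(\<lambda>n. J (u n)) \<longlonglongrightarrow> J y"
    unfolding J_def
    by (intro tendsto_diff tendsto_power tendsto_norm tendsto_mult_left tendsto_Re y)
  moreover have "(\<lambda>n. m + \<epsilon> n) \<longlonglongrightarrow> m"
    unfolding \<epsilon>_def by (rule LIMSEQ_inverse_real_of_nat_add)
  ultimately have "J y \<le> m" using u by (intro LIMSEQ_le[of "\<lambda>n. J (u n)"]) (auto intro: less_imp_le)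
  have "\<phi> x = cinner x y" for x
  proof -
    \<comment> \<open>This is \<open>J (y + c *\<^sub>C x) - J y\<close> written out; a vanishing
      constant term forces the linear coefficient to vanish.\<close>
    have "0 \<le> 0 + 2 * Re (c * (cinner x y - \<phi> x)) + (cmod c)\<^sup>2 * (norm x)\<^sup>2" for c
      using m_le[of "y + c *\<^sub>C x"] \<open>J y \<le> m\<close> norm_add_sq[of y "c *\<^sub>C x"]
      by (simp add: J_def add scale cinner_simps norm_scaleC power_mult_distrib algebra_simps)
    then have "(cmod (cinner x y - \<phi> x))\<^sup>2 \<le> 0 * (norm x)\<^sup>2"
      by (rule quadratic_nonneg_imp_le) simp
    then show ?thesis by simp
  qed
  then show ?thesis by blast
qed

section \<open>Bounded complex linear operators\<close>

lemma bounded_clinearI: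
  assumes "\<And>x y. A (x + y) = A x + A y" and "\<And>c x. A (c *\<^sub>C x) = c *\<^sub>C A x"
    and "\<And>x. norm (A x) \<le> K * norm (x::'a::chilbert_space)"
  shows "bounded_clinear A"
  unfolding bounded_clinear_def
proof
  show "bounded_linear A"
    by (rule bounded_linear_intro[of _ K]) (simp_all add: assms scaleR_scaleC mult.commute[of _ K])
qed (simp add: assms)

lemma bounded_clinear_bounded_linear: "bounded_clinear A \<Longrightarrow> bounded_linear A"
  by (simp add: bounded_clinear_def)

lemma bounded_clinear_scaleC: "bounded_clinear A \<Longrightarrow> A (c *\<^sub>C x) = c *\<^sub>C A x"
  by (simp add: bounded_clinear_def)

lemma bounded_clinear_bound:
  assumes "bounded_clinear A"
  obtains K where "0 < K" "\<And>x. norm (A x) \<le> K * norm x"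
  using bounded_linear.pos_bounded[OF bounded_clinear_bounded_linear[OF assms]]
  by (auto simp: mult.commute)

lemmas bounded_clinear_simps =
  linear_add[OF bounded_linear.linear[OF bounded_clinear_bounded_linear]]
  linear_diff[OF bounded_linear.linear[OF bounded_clinear_bounded_linear]]
  linear_0[OF bounded_linear.linear[OF bounded_clinear_bounded_linear]]
  linear_scale[OF bounded_linear.linear[OF bounded_clinear_bounded_linear]]
  bounded_clinear_scaleC

lemma bounded_clinear_comp:
  "bounded_clinear A \<Longrightarrow> bounded_clinear B \<Longrightarrow> bounded_clinear (A \<circ> B)"
  by (simp add: bounded_clinear_def comp_def bounded_linear_compose)

lemma bounded_clinear_id: "bounded_clinear (\<lambda>x. x)"
  by (simp add: bounded_clinear_def)

lemma bounded_clinear_zero: "bounded_clinear (\<lambda>x. 0)"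
  by (simp add: bounded_clinear_def)

lemma bounded_clinear_add:
  "bounded_clinear A \<Longrightarrow> bounded_clinear B \<Longrightarrow> bounded_clinear (\<lambda>x. A x + B x)"
  by (simp add: bounded_clinear_def bounded_linear_add complex_vector.scale_right_distrib)

lemma bounded_clinear_diff:
  "bounded_clinear A \<Longrightarrow> bounded_clinear B \<Longrightarrow> bounded_clinear (\<lambda>x. A x - B x)"
  by (simp add: bounded_clinear_def bounded_linear_sub complex_vector.scale_right_diff_distrib)

lemma bounded_clinear_const_scaleC:
  assumes "bounded_clinear A" shows "bounded_clinear (\<lambda>x. c *\<^sub>C A x)"
proof -
  obtain K where "0 < K" and K: "\<And>x. norm (A x) \<le> K * norm x"
    using bounded_clinear_bound[OF assms] by blast
  show ?thesis
  proof (rule bounded_clinearI)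
    show "norm (c *\<^sub>C A x) \<le> (cmod c * K) * norm x" for x
      using mult_left_mono[OF K, of "cmod c"] by (simp add: norm_scaleC mult.assoc)
  qed (simp_all add: bounded_clinear_simps[OF assms] complex_vector.scale_right_distrib mult.commute)
qed

lemma bounded_clinear_const_scaleR:
  "bounded_clinear A \<Longrightarrow> bounded_clinear (\<lambda>x. r *\<^sub>R A x)"
  by (simp add: scaleR_scaleC bounded_clinear_const_scaleC)

lemma bounded_clinear_sum:
  assumes "\<And>i. i \<in> F \<Longrightarrow> bounded_clinear (A i)"
  shows "bounded_clinear (\<lambda>x. \<Sum>i\<in>F. A i x)"
  using assms
  by (induction F rule: infinite_finite_induct) (simp_all add: bounded_clinear_zero bounded_clinear_add)

lemmas bounded_clinear_intros = bounded_clinear_comp bounded_clinear_id bounded_clinear_zero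
  bounded_clinear_add bounded_clinear_diff bounded_clinear_const_scaleC
  bounded_clinear_const_scaleR bounded_clinear_sum

context sesquilinear begin

text \<open>For fixed \<open>x\<close> the conjugate of \<open>q x\<close> is a bounded linear
  functional, so Riesz gives a vector \<open>R x\<close>; linearity of \<open>R\<close> is then read
  off the form. It produces both adjoints and densities of functionals.\<close>

lemma represented_by_operator:
  assumes bound: "\<And>x y. cmod (q x y) \<le> K * norm x * norm y"
  obtains R where "bounded_clinear R" "\<And>x y. q x y = cinner (R x) y"
proof -
  have "\<exists>r. \<forall>y. cnj (q x y) = cinner y r" for x
    by (rule Riesz_representation[of _ "K * norm x"])
      (simp_all add: add_right scale_right bound)
  then obtain R where "\<And>x y. cnj (q x y) = cinner y (R x)" by metis
  then have R: "q x y = cinner (R x) y" for x y by (metis cinner_commute complex_cnj_cnj)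
  have "norm (R x) \<le> K * norm x" for x
  proof (cases "R x = 0")
    case True
    \<comment> \<open>No sign of \<open>K\<close> is assumed; the bound at \<open>(x, x)\<close>
      supplies it.\<close>
    have "0 \<le> K * norm x * norm x" using order_trans[OF norm_ge_zero bound[of x x]] .
    with True show ?thesis by (cases "x = 0") (auto simp: zero_le_mult_iff)
  next
    case False
    \<comment> \<open>Tests the bound with the vector \<open>R x\<close> itself.\<close>
    have "(norm (R x))\<^sup>2 \<le> K * norm x * norm (R x)"
      using bound[of x "R x"] by (simp add: R cinner_self norm_power)
    with False show ?thesis by (simp add: power2_eq_square)
  qed
  moreover have "R (x + y) = R x + R y" for x y
    by (rule cinner_eqI) (simp only: cinner_simps R[symmetric] add_left)
  moreover have "R (c *\<^sub>C x) = c *\<^sub>C R x" for c x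
    by (rule cinner_eqI) (simp only: cinner_simps R[symmetric] scale_left)
  ultimately have "bounded_clinear R" by (intro bounded_clinearI)
  with R show thesis using that by blast
qed

end

section \<open>Adjoints of bounded operators\<close>

lemma adjoint_exists:
  assumes A: "bounded_clinear A"
  obtains B where "bounded_clinear B" "\<And>x y. cinner (A x) y = cinner x (B y)"
proof -
  obtain K where "0 < K" and K: "\<And>x. norm (A x) \<le> K * norm x"
    using bounded_clinear_bound[OF A] by blast
  interpret sesquilinear "\<lambda>x y. cinner x (A y)"
    by standard (simp_all add: bounded_clinear_simps[OF A] cinner_simps)
  have "cmod (cinner x (A y)) \<le> K * norm x * norm y" for x y
    using norm_cinner_le[of x "A y"] mult_left_mono[OF K[of y], of "norm x"]
    by (simp add: mult.left_commute mult.assoc)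
  then obtain B where B: "bounded_clinear B" "\<And>x y. cinner x (A y) = cinner (B x) y"
    by (rule represented_by_operator) blast
  have "cinner (A x) y = cinner x (B y)" for x y
    using B(2)[of y x] by (metis cinner_commute)
  with B(1) show thesis by (rule that)
qed

lemma cadjoint_eqI:
  assumes "bounded_clinear B" "\<And>x y. cinner (A x) y = cinner x (B y)"
  shows "cadjoint A = B"
  unfolding cadjoint_def
proof (rule the_equality)
  fix C assume C: "bounded_clinear C \<and> (\<forall>x y. cinner (A x) y = cinner x (C y))"
  show "C = B"
  proof
    show "C x = B x" for x
      by (rule cinner_eqI_right) (use C assms(2) in metis)
  qed
qed (use assms in blast)

lemma
  assumes "bounded_clinear A"
  shows bounded_clinear_cadjoint: "bounded_clinear (cadjoint A)"
    and cinner_cadjoint: "cinner (A x) y = cinner x (cadjoint A y)"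
  using adjoint_exists[OF assms] cadjoint_eqI by metis+

lemma cinner_cadjoint_left:
  assumes "bounded_clinear A" shows "cinner (cadjoint A x) y = cinner x (A y)"
  using cinner_cadjoint[OF assms, of y x] by (subst cinner_commute) (simp flip: cinner_commute)

section \<open>Positive operators and their square roots\<close>

lemma positive_opD:
  assumes "positive_op P"
  shows "bounded_clinear P" "0 \<le> cinner (P x) x"
  using assms by (auto simp: positive_op_def)

lemma Re_cinner_positive: "positive_op P \<Longrightarrow> 0 \<le> Re (cinner (P x) x)"
  using positive_opD(2)[of P x] by (simp add: less_eq_complex_def)

lemma positive_form_positive_op:
  assumes "positive_op P" shows "positive_form (\<lambda>x y. cinner (P x) y)"
  by standard (simp_all add: bounded_clinear_simps[OF positive_opD(1)[OF assms]] cinner_simps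
      positive_opD(2)[OF assms])

lemma positive_op_selfadjoint:
  assumes "positive_op P" shows "cinner (P x) y = cinner x (P y)"
  using positive_form.hermitian[OF positive_form_positive_op[OF assms], of x y]
  by (metis cinner_commute)

lemma cadjoint_positive_op: "positive_op P \<Longrightarrow> cadjoint P = P"
  by (intro cadjoint_eqI) (simp_all add: positive_opD positive_op_selfadjoint)

text \<open>Cauchy-Schwarz for the form of \<open>P\<close> at the pair \<open>x\<close>,
  \<open>P x\<close>, followed by division by \<open>(norm (P x))\<^sup>2\<close>. It upgrades
  information on quadratic forms to norms.\<close>

lemma positive_op_norm_sq_le:
  assumes P: "positive_op P" and K: "\<And>y. Re (cinner (P y) y) \<le> K * (norm y)\<^sup>2"
  shows "(norm (P x))\<^sup>2 \<le> K * Re (cinner (P x) x)"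
proof (cases "P x = 0")
  case False
  have "((norm (P x))\<^sup>2)\<^sup>2 \<le> Re (cinner (P x) x) * Re (cinner (P (P x)) (P x))"
    using positive_form.Cauchy_Schwarz[OF positive_form_positive_op[OF P], of x "P x"]
    by (simp add: cinner_self norm_power)
  also have "\<dots> \<le> Re (cinner (P x) x) * (K * (norm (P x))\<^sup>2)"
    by (intro mult_left_mono K Re_cinner_positive P)
  finally have "(norm (P x))\<^sup>2 * (norm (P x))\<^sup>2 \<le> (K * Re (cinner (P x) x)) * (norm (P x))\<^sup>2"
    by (simp add: power2_eq_square algebra_simps)
  with False show ?thesis by (subst (asm) mult_le_cancel_right) simp
next
  case True then show ?thesis by (simp add: cinner_simps)
qed

lemma positive_op_bound:
  assumes "positive_op P"
  obtains K where "0 < K" "\<And>y. norm (P y) \<le> K * norm y" "\<And>y. Re (cinner (P y) y) \<le> K * (norm y)\<^sup>2"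
proof -
  obtain K where K: "0 < K" "\<And>y. norm (P y) \<le> K * norm y"
    using bounded_clinear_bound[OF positive_opD(1)[OF assms]] by blast
  have "Re (cinner (P y) y) \<le> K * (norm y)\<^sup>2" for y
    using complex_Re_le_cmod[of "cinner (P y) y"] norm_cinner_le[of "P y" y]
      mult_right_mono[OF K(2), of "norm y" y] by (simp add: power2_eq_square)
  with K show thesis by (rule that)
qed

lemma positive_op_cinner_eq_0:
  assumes P: "positive_op P" and "Re (cinner (P x) x) = 0"
  shows "P x = 0"
proof -
  obtain K where K: "\<And>y. Re (cinner (P y) y) \<le> K * (norm y)\<^sup>2" using positive_op_bound[OF P] by metis
  from positive_op_norm_sq_le[OF P K, of x] assms(2) show ?thesis by simp
qed

text \<open>Selfadjointness makes the quadratic form real, so only its real part remains to be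
  checked.\<close>

lemma positive_opI:
  assumes A: "bounded_clinear A" and sa: "\<And>x y. cinner (A x) y = cinner x (A y)"
    and "\<And>x. 0 \<le> Re (cinner (A x) x)"
  shows "positive_op A"
proof -
  have "Im (cinner (A x) x) = 0" for x
  proof -
    have "cinner (A x) x = cnj (cinner (A x) x)" using sa[of x x] cinner_commute[of x "A x"] by simp
    then show ?thesis by (simp add: complex_eq_iff)
  qed
  with assms show ?thesis by (simp add: positive_op_def less_eq_complex_def)
qed

lemma positive_op_scaleR:
  assumes P: "positive_op P" and "0 \<le> r"
  shows "positive_op (\<lambda>x. r *\<^sub>R P x)"
proof (rule positive_opI)
  show "cinner (r *\<^sub>R P x) y = cinner x (r *\<^sub>R P y)" for x y
    by (simp add: scaleR_scaleC cinner_simps positive_op_selfadjoint[OF P])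
  show "0 \<le> Re (cinner (r *\<^sub>R P x) x)" for x
    using \<open>0 \<le> r\<close> Re_cinner_positive[OF P, of x] by (simp add: scaleR_scaleC cinner_simps)
qed (intro bounded_clinear_intros positive_opD(1) P)

lemma op_leI:
  assumes A: "positive_op A" and B: "positive_op B"
    and le: "\<And>x. Re (cinner (A x) x) \<le> Re (cinner (B x) x)"
  shows "op_le A B"
  unfolding op_le_def
proof (rule positive_opI)
  show "cinner (B x - A x) y = cinner x (B y - A y)" for x y
    by (simp add: cinner_simps positive_op_selfadjoint[OF A] positive_op_selfadjoint[OF B])
  show "0 \<le> Re (cinner (B x - A x) x)" for x
    using le[of x] by (simp add: cinner_simps)
qed (intro bounded_clinear_intros positive_opD(1) A B)

lemma op_leD: "op_le A B \<Longrightarrow> Re (cinner (A x) x) \<le> Re (cinner (B x) x)"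
  using Re_cinner_positive[of "\<lambda>x. B x - A x" x] by (simp add: op_le_def cinner_simps)

text \<open>The iteration \<open>Y\<^sub>n\<^sub>+\<^sub>1 = (X + Y\<^sub>n\<^sup>2) / 2\<close> with \<open>X = 1 - P\<close> converges to \<open>1 - sqrt P\<close>; its increments are
  dominated in norm by those of the scalar iteration \<open>y\<^sub>n\<^sub>+\<^sub>1 = (1 + y\<^sub>n\<^sup>2) / 2\<close>, which increases to 1.\<close>

lemma positive_contraction_sqrt:
  fixes P :: "'a::chilbert_space \<Rightarrow> 'a"
  assumes P: "positive_op P" and contr: "\<And>x. norm (P x) \<le> norm x"
  obtains Q where "positive_op Q" "Q \<circ> Q = P"
    "\<And>C x. bounded_clinear C \<Longrightarrow> (\<And>x. C (P x) = P (C x)) \<Longrightarrow> C (Q x) = Q (C x)"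
proof -
  note Pbc = positive_opD(1)[OF P]
  have bl: "bounded_linear (\<lambda>x. x - P x)"
    using Pbc by (intro bounded_linear_intros bounded_clinear_bounded_linear)
  define X where "X = Blinfun (\<lambda>x. x - P x)"
  have X: "blinfun_apply X x = x - P x" for x
    unfolding X_def by (simp add: bounded_linear_Blinfun_apply[OF bl])
  have "Re (cinner (P y) y) \<le> 1 * (norm y)\<^sup>2" for y
    using complex_Re_le_cmod[of "cinner (P y) y"] norm_cinner_le[of "P y" y]
      mult_right_mono[OF contr[of y], of "norm y"] by (simp add: power2_eq_square)
  from positive_op_norm_sq_le[OF P this]
  have P2: "(norm (P x))\<^sup>2 \<le> Re (cinner (P x) x)" for x by simp
  \<comment> \<open>Expanding the square, \<open>P2\<close> absorbs the last term into one copy of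
    \<open>cinner (P x) x\<close>.\<close>
  have "norm (x - P x) \<le> norm x" for x
  proof (rule power2_le_imp_le)
    have "(norm (x - P x))\<^sup>2 = (norm x)\<^sup>2 - 2 * Re (cinner (P x) x) + (norm (P x))\<^sup>2"
      using norm_add_sq[of x "- P x"] by (simp add: cinner_simps)
    with P2[of x] Re_cinner_positive[OF P, of x] show "(norm (x - P x))\<^sup>2 \<le> (norm x)\<^sup>2" by linarith
  qed simp
  then have normX: "norm X \<le> 1" by (intro norm_blinfun_bound) (simp_all add: X)
  define Y where "Y = rec_nat 0 (\<lambda>_ Z. (1/2) *\<^sub>R (X + (Z o\<^sub>L Z)))"
  have Y0: "Y 0 = 0" and YS: "Y (Suc n) = (1/2) *\<^sub>R (X + (Y n o\<^sub>L Y n))" for n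
    by (simp_all add: Y_def)
  define y :: "nat \<Rightarrow> real" where "y = rec_nat 0 (\<lambda>_ z. (1 + z\<^sup>2) / 2)"
  have y0: "y 0 = 0" and yS: "y (Suc n) = (1 + (y n)\<^sup>2) / 2" for n
    by (simp_all add: y_def)
  have y_bounds: "0 \<le> y n \<and> y n \<le> 1" for n
  proof (induction n)
    case (Suc n)
    then have "(y n)\<^sup>2 \<le> 1" by (simp add: power_le_one)
    then show ?case by (simp add: yS)
  qed (simp add: y0)
  have "y n \<le> y (Suc n)" for n
  proof -
    have "0 \<le> (1 - y n)\<^sup>2" by simp
    then show ?thesis by (simp add: yS power2_diff)
  qed
  then have "incseq y" by (rule incseq_SucI)
  have normY: "norm (Y n) \<le> y n" for n
  proof (induction n)
    case (Suc n)
    have "norm (Y n o\<^sub>L Y n) \<le> norm (Y n) * norm (Y n)" by (rule norm_blinfun_compose)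
    also have "\<dots> \<le> y n * y n" using Suc y_bounds[of n] by (intro mult_mono) auto
    finally have "norm (X + (Y n o\<^sub>L Y n)) \<le> 1 + y n * y n"
      using norm_triangle_ineq[of X "Y n o\<^sub>L Y n"] normX by linarith
    then show ?case by (simp add: YS yS power2_eq_square)
  qed (simp add: Y0 y0)
  have increment: "norm (Y (Suc n) - Y n) \<le> y (Suc n) - y n" for n
  proof (induction n)
    case 0
    show ?case using normY[of "Suc 0"] by (simp add: Y0 y0)
  next
    case (Suc n)
    let ?Z = "Y (Suc n)" and ?z = "y (Suc n)"
    \<comment> \<open>Difference of squares as \<open>Z (Z - W) + (Z - W) W\<close>, valid for
      noncommuting factors. The scalar increment has the same factorisation, so the two recursions
      can be compared term by term.\<close>
    have "Y (Suc (Suc n)) - ?Z = (1/2) *\<^sub>R ((?Z o\<^sub>L (?Z - Y n)) + ((?Z - Y n) o\<^sub>L Y n))"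
    proof (rule blinfun_eqI)
      show "blinfun_apply (Y (Suc (Suc n)) - ?Z) x =
          blinfun_apply ((1/2) *\<^sub>R ((?Z o\<^sub>L (?Z - Y n)) + ((?Z - Y n) o\<^sub>L Y n))) x" for x
        unfolding YS[of "Suc n"]
        by (subst (3) YS) (simp add: blinfun.bilinear_simps algebra_simps)
    qed
    also have "norm \<dots> \<le> (norm (?Z o\<^sub>L (?Z - Y n)) + norm ((?Z - Y n) o\<^sub>L Y n)) / 2"
      using norm_triangle_ineq[of "?Z o\<^sub>L (?Z - Y n)" "(?Z - Y n) o\<^sub>L Y n"] by simp
    also have "norm (?Z o\<^sub>L (?Z - Y n)) \<le> ?z * (?z - y n)"
      using norm_blinfun_compose[of ?Z "?Z - Y n"]
        mult_mono[OF normY[of "Suc n"] Suc] y_bounds[of "Suc n"] by fastforce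
    also have "norm ((?Z - Y n) o\<^sub>L Y n) \<le> (?z - y n) * y n"
      using norm_blinfun_compose[of "?Z - Y n" "Y n"]
        mult_mono[OF Suc normY[of n]] incseq_SucD[OF \<open>incseq y\<close>, of n] by fastforce
    also have "(?z * (?z - y n) + (?z - y n) * y n) / 2 = y (Suc (Suc n)) - ?z"
      unfolding yS[of "Suc n"] by (subst (5) yS) (simp add: power2_eq_square field_simps)
    finally show ?case by simp
  qed
  have diff: "norm (Y m - Y n) \<le> y m - y n" if "n \<le> m" for m n
    using that
  proof (induction m rule: dec_induct)
    case (step m)
    have "norm (Y (Suc m) - Y n) \<le> norm (Y (Suc m) - Y m) + norm (Y m - Y n)"
      using norm_triangle_ineq[of "Y (Suc m) - Y m" "Y m - Y n"] by simp
    with step.IH increment[of m] show ?case by linarith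
  qed simp
  \<comment> \<open>Bounded and increasing, hence Cauchy; by \<open>diff\<close> this carries over
    to \<open>Y\<close> in operator norm.\<close>
  have "Cauchy y"
    by (rule convergent_Cauchy) (metis incseq_convergent[OF \<open>incseq y\<close>] convergent_def y_bounds)
  have "Cauchy Y"
  proof (rule metric_CauchyI)
    fix e :: real assume "0 < e"
    then obtain N where N: "\<And>i j. N \<le> i \<Longrightarrow> N \<le> j \<Longrightarrow> dist (y i) (y j) < e"
      using metric_CauchyD[OF \<open>Cauchy y\<close>] by metis
    have "dist (Y i) (Y j) < e" if "N \<le> i" "N \<le> j" for i j
    proof -
      have "dist (Y i) (Y j) \<le> dist (y i) (y j)"
        using diff[of i j] diff[of j i]
        by (cases "i \<le> j") (auto simp: dist_norm norm_minus_commute abs_if)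
      with N[OF that] show ?thesis by simp
    qed
    then show "\<exists>M. \<forall>i\<ge>M. \<forall>j\<ge>M. dist (Y i) (Y j) < e" by blast
  qed
  then obtain L where L: "Y \<longlonglongrightarrow> L" using Cauchy_convergent convergent_def by blast
  have "(\<lambda>n. Y (Suc n)) \<longlonglongrightarrow> (1/2) *\<^sub>R (X + (L o\<^sub>L L))"
    unfolding YS
    by (intro tendsto_scaleR tendsto_const tendsto_add L
        bounded_bilinear.tendsto[OF bounded_bilinear_blinfun_compose])
  then have "L = (1/2) *\<^sub>R (X + (L o\<^sub>L L))"
    using LIMSEQ_Suc[OF L] LIMSEQ_unique by blast
  from arg_cong[OF this, of "\<lambda>l. blinfun_apply l x" for x]
  have Lfix: "blinfun_apply L x = (1/2) *\<^sub>R (x - P x + L (L x))" for x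
    by (simp only: blinfun.add_left blinfun.scaleR_left blinfun_apply_blinfun_compose X)
  have Lx: "(\<lambda>n. blinfun_apply (Y n) x) \<longlonglongrightarrow> L x" for x
    by (intro bounded_bilinear.tendsto[OF bounded_bilinear_blinfun_apply] L tendsto_const)
  have Ln: "norm (blinfun_apply L x) \<le> norm x" for x
  proof -
    have "norm (blinfun_apply (Y n) x) \<le> norm x" for n
    proof -
      have "norm (blinfun_apply (Y n) x) \<le> norm (Y n) * norm x" by (rule norm_blinfun)
      also have "\<dots> \<le> 1 * norm x"
        using normY[of n] y_bounds[of n] by (intro mult_right_mono) auto
      finally show ?thesis by simp
    qed
    then show ?thesis by (intro LIMSEQ_le_const2[OF tendsto_norm[OF Lx]]) auto
  qed
  \<comment> \<open>Each iterate is a polynomial in \<open>P\<close>, so it commutes with whatever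
    commutes with \<open>P\<close>; continuity of \<open>C\<close> passes this to the limit.\<close>
  have commute: "C (blinfun_apply L x) = L (C x)"
    if C: "bounded_clinear C" and CP: "\<And>x. C (P x) = P (C x)" for C x
  proof -
    have "C (blinfun_apply (Y n) x) = Y n (C x)" for n x
    proof (induction n arbitrary: x)
      case (Suc n)
      show ?case
        by (simp add: YS blinfun.bilinear_simps bounded_clinear_simps[OF C] X CP Suc)
    qed (simp add: Y0 bounded_clinear_simps[OF C])
    then show ?thesis
      using bounded_linear.tendsto[OF bounded_clinear_bounded_linear[OF C] Lx[of x]] Lx[of "C x"]
        LIMSEQ_unique by simp
  qed
  have Lsa: "cinner (blinfun_apply L x) z = cinner x (L z)" for x z
  proof -
    have "cinner (blinfun_apply (Y n) x) z = cinner x (Y n z)" for n x z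
    proof (induction n arbitrary: x z)
      case (Suc n)
      show ?case
        by (simp add: YS blinfun.bilinear_simps X cinner_simps scaleR_scaleC Suc
            positive_op_selfadjoint[OF P])
    qed (simp add: Y0 cinner_simps)
    then show ?thesis
      using tendsto_cinner[OF Lx[of x] tendsto_const, of z] tendsto_cinner[OF tendsto_const Lx[of z], of x]
        LIMSEQ_unique by simp
  qed
  have LC: "bounded_clinear (blinfun_apply L)"
  proof (rule bounded_clinearI[of _ 1])
    \<comment> \<open>Bounded linear functions of this type are only real linear. Complex
      homogeneity is obtained as commutation with the operator of multiplication by
      \<open>c\<close>.\<close>
    show "L (c *\<^sub>C x) = c *\<^sub>C L x" for c x
      by (rule commute[symmetric])
        (intro bounded_clinear_intros, simp add: bounded_clinear_simps[OF Pbc])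
  qed (simp_all add: blinfun.bilinear_simps Ln)
  define Q where "Q x = x - blinfun_apply L x" for x
  have "positive_op Q"
    unfolding Q_def
  proof (rule positive_opI)
    show "cinner (x - L x) z = cinner x (z - L z)" for x z
      by (simp add: cinner_simps Lsa)
    show "0 \<le> Re (cinner (x - L x) x)" for x
      using complex_Re_le_cmod[of "cinner (L x) x"] norm_cinner_le[of "L x" x]
        mult_right_mono[OF Ln[of x], of "norm x"]
      by (simp add: cinner_simps Re_cinner_self power2_eq_square)
  qed (intro bounded_clinear_intros LC)
  moreover have "Q \<circ> Q = P"
  proof
    fix x
    \<comment> \<open>The fixed point equation \<open>2 L = 1 - P + L\<^sup>2\<close> says exactly
      that \<open>(1 - L)\<^sup>2 = P\<close>.\<close>
    have "2 *\<^sub>R blinfun_apply L x = x - P x + L (L x)" by (subst Lfix) simp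
    then show "(Q \<circ> Q) x = P x"
      by (simp add: Q_def blinfun.bilinear_simps scaleR_2 algebra_simps)
  qed
  moreover have "C (Q x) = Q (C x)" if "bounded_clinear C" "\<And>x. C (P x) = P (C x)" for C x
    using commute[OF that] by (simp add: Q_def bounded_clinear_simps[OF that(1)])
  ultimately show thesis by (rule that)
qed

text \<open>Rescaling by a norm bound \<open>K\<close> reduces to contractions, and
  \<open>sqrt K\<close> undoes the scaling. The commutation clause is carried along for the
  uniqueness proof.\<close>

lemma positive_op_sqrt:
  assumes P: "positive_op P"
  obtains Q where "positive_op Q" "Q \<circ> Q = P"
    "\<And>C x. bounded_clinear C \<Longrightarrow> (\<And>x. C (P x) = P (C x)) \<Longrightarrow> C (Q x) = Q (C x)"
proof -
  obtain K where K: "0 < K" "\<And>x. norm (P x) \<le> K * norm x"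
    using positive_op_bound[OF P] by metis
  define P' where "P' x = inverse K *\<^sub>R P x" for x
  have "positive_op P'"
    unfolding P'_def using K(1) by (intro positive_op_scaleR P) simp
  moreover have "norm (P' x) \<le> norm x" for x
    using K(2)[of x] K(1) by (simp add: P'_def field_simps)
  ultimately obtain Q' where Q': "positive_op Q'" "Q' \<circ> Q' = P'"
    and comm: "\<And>C x. bounded_clinear C \<Longrightarrow> (\<And>x. C (P' x) = P' (C x)) \<Longrightarrow> C (Q' x) = Q' (C x)"
    by (rule positive_contraction_sqrt) blast
  define Q where "Q x = sqrt K *\<^sub>R Q' x" for x
  have "positive_op Q"
    unfolding Q_def using K(1) by (intro positive_op_scaleR Q'(1)) simp
  moreover have "Q \<circ> Q = P"
  proof
    fix x
    have "(Q \<circ> Q) x = (sqrt K * sqrt K) *\<^sub>R Q' (Q' x)"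
      by (simp add: Q_def bounded_clinear_simps[OF positive_opD(1)[OF Q'(1)]] del: real_sqrt_mult_self)
    also have "\<dots> = P x" using fun_cong[OF Q'(2), of x] K(1) by (simp add: P'_def)
    finally show "(Q \<circ> Q) x = P x" .
  qed
  moreover have "C (Q x) = Q (C x)" if C: "bounded_clinear C" and "\<And>x. C (P x) = P (C x)" for C x
    using comm[OF C, of x] that(2) by (simp add: Q_def P'_def bounded_clinear_simps[OF C])
  ultimately show thesis by (rule that)
qed

section \<open>Uniqueness of positive square roots\<close>

text \<open>For \<open>d = Q x - R x\<close> the hypotheses give \<open>(Q + R) d = 0\<close>. Both
  forms are nonnegative, so \<open>Q d = R d = 0\<close>, and then
  \<open>cinner d d = cinner x ((Q - R) d) = 0\<close>.\<close>

lemma positive_op_eq_of_commute: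
  assumes Q: "positive_op Q" and R: "positive_op R"
    and sq: "\<And>x. Q (Q x) = R (R x)" and comm: "\<And>x. R (Q x) = Q (R x)"
  shows "Q x = R x"
proof -
  note lin = bounded_clinear_simps[OF positive_opD(1)[OF Q]] bounded_clinear_simps[OF positive_opD(1)[OF R]]
  define d where "d = Q x - R x"
  have "Q d + R d = 0" by (simp add: d_def lin sq comm)
  then have "Re (cinner (Q d) d) + Re (cinner (R d) d) = 0"
    by (metis cinner.add_left cinner.zero_left plus_complex.sel(1) zero_complex.sel(1))
  then have "Re (cinner (Q d) d) = 0" "Re (cinner (R d) d) = 0"
    using Re_cinner_positive[OF Q, of d] Re_cinner_positive[OF R, of d] by linarith+
  then have "Q d = 0" "R d = 0"
    using positive_op_cinner_eq_0[OF Q] positive_op_cinner_eq_0[OF R] by auto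
  then have "cinner d d = 0"
    by (subst d_def)
      (simp add: cinner_simps positive_op_selfadjoint[OF Q] positive_op_selfadjoint[OF R])
  then show ?thesis by (simp add: cinner_self d_def)
qed

text \<open>The constructed root \<open>Q\<close> of \<open>S \<circ> S\<close> commutes with
  everything that commutes with that square, in particular with \<open>S\<close> and with
  \<open>R\<close>, and so equals both. This identifies the modulus in \<open>trace_class\<close>
  with the operator when the latter is positive.\<close>

lemma positive_op_square_inject:
  assumes S: "positive_op S" and R: "positive_op R" and eq: "R \<circ> R = S \<circ> S"
  shows "R = S"
proof -
  have eq': "R (R x) = S (S x)" for x using fun_cong[OF eq, of x] by simp
  have "positive_op (S \<circ> S)"
  proof (rule positive_opI)
    show "0 \<le> Re (cinner ((S \<circ> S) x) x)" for x
      by (simp add: positive_op_selfadjoint[OF S, of "S x" x] Re_cinner_self)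
  qed (simp_all add: bounded_clinear_comp positive_opD(1)[OF S] positive_op_selfadjoint[OF S])
  then obtain Q where Q: "positive_op Q" "Q \<circ> Q = S \<circ> S"
    and comm: "\<And>C x. bounded_clinear C \<Longrightarrow> (\<And>x. C ((S \<circ> S) x) = (S \<circ> S) (C x)) \<Longrightarrow> C (Q x) = Q (C x)"
    by (rule positive_op_sqrt) blast
  have QQ: "Q (Q x) = S (S x)" for x using fun_cong[OF Q(2), of x] by simp
  have "S (Q x) = Q (S x)" for x by (rule comm) (simp_all add: positive_opD(1)[OF S])
  then have "Q x = S x" for x
    by (intro positive_op_eq_of_commute[OF Q(1) S] QQ)
  moreover have "R (Q x) = Q (R x)" for x
    by (rule comm) (simp_all add: positive_opD(1)[OF R] flip: eq')
  then have "Q x = R x" for x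
    by (intro positive_op_eq_of_commute[OF Q(1) R]) (simp_all add: QQ eq')
  ultimately show ?thesis by (intro ext) metis
qed

section \<open>Orthonormal bases and the trace\<close>

definition onb_proj :: "'a::chilbert_space set \<Rightarrow> 'a \<Rightarrow> 'a"
  where "onb_proj F x = (\<Sum>e\<in>F. cinner x e *\<^sub>C e)"

lemma onb_proj_add: "onb_proj F (x + y) = onb_proj F x + onb_proj F y"
  by (simp add: onb_proj_def cinner_simps complex_vector.scale_left_distrib sum.distrib)

lemma onb_proj_scaleC: "onb_proj F (c *\<^sub>C x) = c *\<^sub>C onb_proj F x"
  by (simp add: onb_proj_def cinner_simps complex_vector.scale_sum_right)

lemma onb_proj_diff: "onb_proj F (x - y) = onb_proj F x - onb_proj F y"
  by (simp add: onb_proj_def cinner_simps complex_vector.scale_left_diff_distrib sum_subtractf)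

lemma onb_cinner: "is_onb E \<Longrightarrow> e \<in> E \<Longrightarrow> f \<in> E \<Longrightarrow> cinner e f = (if e = f then 1 else 0)"
  by (simp add: is_onb_def)

lemma onb_proj_eq:
  assumes E: "is_onb E" and F: "finite F" "F \<subseteq> E" and e: "e \<in> F"
  shows "onb_proj F e = e"
proof -
  have "onb_proj F e = (\<Sum>f\<in>F. if f = e then e else 0)"
    unfolding onb_proj_def
    by (rule sum.cong) (use onb_cinner[OF E] F e in \<open>auto simp: subset_iff\<close>)
  with F e show ?thesis by simp
qed

text \<open>The remainder is orthogonal to every \<open>e \<in> F\<close>, hence to the projection.
  Both positivity and contractivity of the complementary projection follow.\<close>

lemma Re_cinner_minus_onb_proj:
  assumes E: "is_onb E" and F: "finite F" "F \<subseteq> E"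
  shows "Re (cinner (x - onb_proj F x) x) = (norm (x - onb_proj F x))\<^sup>2"
proof -
  have orth: "cinner e (x - onb_proj F x) = 0" if "e \<in> F" for e
  proof -
    have "cinner (onb_proj F x) e = (\<Sum>f\<in>F. if f = e then cinner x e else 0)"
      unfolding onb_proj_def cinner.sum_left cinner.scale_left
      by (rule sum.cong) (use onb_cinner[OF E] F that in \<open>auto simp: subset_iff\<close>)
    then have "cinner (x - onb_proj F x) e = 0" using F that by (simp add: cinner_simps)
    then show ?thesis by (metis cinner_commute complex_cnj_zero)
  qed
  have "cinner (onb_proj F x) (x - onb_proj F x) = 0"
    by (subst onb_proj_def) (simp add: cinner.sum_left cinner.scale_left orth)
  then have "cinner (x - onb_proj F x) (onb_proj F x) = 0" by (metis cinner_commute complex_cnj_zero)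
  then have "cinner (x - onb_proj F x) x = cinner (x - onb_proj F x) (x - onb_proj F x)"
    by (simp add: cinner.diff_right)
  then show ?thesis by (simp add: cinner_self)
qed

lemma norm_minus_onb_proj_le:
  assumes "is_onb E" "finite F" "F \<subseteq> E"
  shows "norm (x - onb_proj F x) \<le> norm x"
proof (cases "x - onb_proj F x = 0")
  case False
  have "norm (x - onb_proj F x) * norm (x - onb_proj F x) \<le> norm (x - onb_proj F x) * norm x"
    using Re_cinner_minus_onb_proj[OF assms, of x] complex_Re_le_cmod[of "cinner (x - onb_proj F x) x"]
      norm_cinner_le[of "x - onb_proj F x" x] by (simp add: power2_eq_square)
  with False show ?thesis by simp
qed simp

text \<open>The partial sums are the projections. They eventually fix each vector of the span, and
  contractivity of the complementary projections extends convergence to the closure.\<close>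

lemma onb_has_sum:
  assumes E: "is_onb E"
  shows "((\<lambda>e. cinner x e *\<^sub>C e) has_sum x) E"
proof -
  \<comment> \<open>Quantifying over all larger finite \<open>G\<close> matches the filter of finite
    subsets and survives enlarging \<open>F\<close> in the span induction.\<close>
  define fixed where
    "fixed F u \<longleftrightarrow> (\<forall>G. finite G \<longrightarrow> F \<subseteq> G \<longrightarrow> G \<subseteq> E \<longrightarrow> onb_proj G u = u)" for F u
  have span: "\<exists>F. finite F \<and> F \<subseteq> E \<and> fixed F u"
    if "u \<in> complex_vector.span E" for u
    using that
  proof (induction rule: complex_vector.span_induct_alt)
    case base
    show ?case by (intro exI[of _ "{}"]) (simp add: fixed_def onb_proj_def cinner_simps)
  next
    case (step c e u)
    then obtain F where F: "finite F" "F \<subseteq> E" "fixed F u" by blast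
    have "onb_proj G (c *\<^sub>C e + u) = c *\<^sub>C e + u"
      if "finite G" "insert e F \<subseteq> G" "G \<subseteq> E" for G
      using that F(3) onb_proj_eq[OF E, of G e]
      by (simp add: fixed_def onb_proj_add onb_proj_scaleC)
    with F step.hyps show ?case by (intro exI[of _ "insert e F"]) (simp add: fixed_def)
  qed
  have "onb_proj F x = sum (\<lambda>e. cinner x e *\<^sub>C e) F" for F by (simp add: onb_proj_def)
  moreover have "((\<lambda>F. onb_proj F x) \<longlongrightarrow> x) (finite_subsets_at_top E)"
  proof (rule tendstoI)
    fix \<epsilon> :: real assume "0 < \<epsilon>"
    have "x \<in> closure (complex_vector.span E)" using E by (simp add: is_onb_def)
    then obtain u where u: "u \<in> complex_vector.span E" "dist u x < \<epsilon>"
      using \<open>0 < \<epsilon>\<close> closure_approachable by blast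
    from span[OF u(1)] obtain F where F: "finite F" "F \<subseteq> E" "fixed F u" by blast
    have "dist (onb_proj G x) x < \<epsilon>" if G: "finite G" "F \<subseteq> G" "G \<subseteq> E" for G
    proof -
      \<comment> \<open>Since \<open>G\<close> fixes \<open>u\<close>, the remainder of
        \<open>x\<close> is the remainder of the small vector \<open>x - u\<close>.\<close>
      have "x - onb_proj G x = (x - u) - onb_proj G (x - u)"
        using F(3) G by (simp add: fixed_def onb_proj_diff)
      then have "norm (x - onb_proj G x) \<le> norm (x - u)"
        using norm_minus_onb_proj_le[OF E G(1,3), of "x - u"] by (simp only:)
      with u(2) show ?thesis by (simp add: dist_norm norm_minus_commute)
    qed
    with F(1,2) show "eventually (\<lambda>G. dist (onb_proj G x) x < \<epsilon>) (finite_subsets_at_top E)"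
      unfolding eventually_finite_subsets_at_top by blast
  qed
  ultimately show ?thesis by (simp add: has_sum_def)
qed

lemma onb_Parseval:
  assumes "is_onb E"
  shows "((\<lambda>e. cinner x e * cinner e y) has_sum cinner x y) E"
  using has_sum_bounded_linear[OF bounded_bilinear.bounded_linear_left[OF bounded_bilinear_cinner]
      onb_has_sum[OF assms], of x y]
  by (simp add: cinner_simps)

lemma cmod_cinner_commute: "cmod (cinner x y) = cmod (cinner y x)"
  by (subst cinner_commute) simp

lemma onb_Parseval_norm:
  assumes "is_onb E"
  shows "((\<lambda>e. (cmod (cinner x e))\<^sup>2) has_sum (norm x)\<^sup>2) E"
proof -
  have "Re (cinner x e * cinner e x) = (cmod (cinner x e))\<^sup>2" for e
    by (subst (2) cinner_commute) (simp add: complex_mult_cnj cmod_power2)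
  with has_sum_Re[OF onb_Parseval[OF assms, of x x]] show ?thesis by (simp add: cinner_self)
qed

section \<open>Double series and independence of the basis\<close>

text \<open>By Parseval, summing the squared matrix entries over \<open>F\<close> gives
  \<open>(norm (A e))\<^sup>2\<close>, which is summable by assumption; all terms are
  nonnegative.\<close>

lemma Hilbert_Schmidt_summable:
  fixes A :: "'a::chilbert_space \<Rightarrow> 'a"
  assumes F: "is_onb F" and A: "(\<lambda>e. (norm (A e))\<^sup>2) summable_on E"
  shows "(\<lambda>(e, f). (cmod (cinner (A e) f))\<^sup>2) summable_on E \<times> F"
proof -
  have "(\<lambda>f. (cmod (cinner x f))\<^sup>2) summable_on F"
    and "(\<Sum>\<^sub>\<infinity>f\<in>F. (cmod (cinner x f))\<^sup>2) = (norm x)\<^sup>2" for x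
    using onb_Parseval_norm[OF F, of x] by (simp_all add: infsumI has_sum_imp_summable)
  then have "(\<lambda>p. norm ((cmod (cinner (A (fst p)) (snd p)))\<^sup>2)) summable_on E \<times> F"
    unfolding Infinite_Sum.abs_summable_on_Sigma_iff using A by simp
  then show ?thesis by (simp add: case_prod_unfold)
qed

text \<open>Expanding \<open>\<langle>B Q e, Q e\<rangle>\<close> in a second orthonormal basis gives an absolutely convergent double
  series; summing it in the other order yields the trace of \<open>B Q\<^sup>2\<close>. This gives independence of
  the basis and positivity of the trace functional at once.\<close>

lemma trace_square_has_sum:
  fixes B Q :: "'a::chilbert_space \<Rightarrow> 'a"
  assumes E: "is_onb E" and F: "is_onb F" and Q: "positive_op Q" and B: "bounded_clinear B"
    and sum: "(\<lambda>e. (norm (Q e))\<^sup>2) summable_on E"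
  obtains t where "((\<lambda>e. cinner (B (Q e)) (Q e)) has_sum t) E"
    "((\<lambda>f. cinner (B (Q (Q f))) f) has_sum t) F"
proof -
  obtain K where K: "0 < K" "\<And>x. norm (B x) \<le> K * norm x" using bounded_clinear_bound[OF B] by metis
  have "(norm (B (Q e)))\<^sup>2 \<le> K\<^sup>2 * (norm (Q e))\<^sup>2" for e
    using power_mono[OF K(2)[of "Q e"], of 2] by (simp add: power_mult_distrib)
  then have "(\<lambda>e. (norm (B (Q e)))\<^sup>2) summable_on E"
    by (intro summable_on_comparison_test[OF summable_on_cmult_right[OF sum, of "K\<^sup>2"]]) auto
  from Hilbert_Schmidt_summable[OF F this] Hilbert_Schmidt_summable[OF F sum]
  have sum2: "(\<lambda>p. (cmod (cinner (B (Q (fst p))) (snd p)))\<^sup>2 + (cmod (cinner (Q (fst p)) (snd p)))\<^sup>2)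
      summable_on E \<times> F"
    by (intro summable_on_add) (simp_all add: case_prod_unfold)
  define a where "a p = cinner (B (Q (fst p))) (snd p) * cinner (snd p) (Q (fst p))" for p
  \<comment> \<open>A product is bounded by the sum of the squares of its factors, so two square
    summable matrices dominate \<open>a\<close>.\<close>
  have "norm (a p) \<le> (cmod (cinner (B (Q (fst p))) (snd p)))\<^sup>2 + (cmod (cinner (Q (fst p)) (snd p)))\<^sup>2" for p
  proof -
    have *: "x * y \<le> x\<^sup>2 + y\<^sup>2" if "0 \<le> x" "0 \<le> y" for x y :: real
    proof -
      have "0 \<le> (x - y)\<^sup>2" by simp
      with mult_nonneg_nonneg[OF that] show ?thesis by (simp only: power2_diff)
    qed
    show ?thesis
      unfolding a_def norm_mult
      by (subst (2) cmod_cinner_commute) (rule *[OF norm_ge_zero norm_ge_zero])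
  qed
  then have "(\<lambda>p. norm (a p)) summable_on E \<times> F"
    by (intro summable_on_comparison_test[OF sum2]) auto
  then have "a summable_on E \<times> F" by (rule abs_summable_summable)
  then obtain t where t: "(a has_sum t) (E \<times> F)" by (auto simp: summable_on_def)
  have "((\<lambda>e. cinner (B (Q e)) (Q e)) has_sum t) E"
    by (rule has_sum_SigmaD[OF t]) (simp add: a_def onb_Parseval[OF F])
  moreover have "((\<lambda>f. cinner (B (Q (Q f))) f) has_sum t) F"
  proof (rule has_sum_SigmaD)
    show "((\<lambda>(x, y). a (y, x)) has_sum t) (F \<times> E)" using t by (subst (asm) has_sum_swap)
    \<comment> \<open>Moving \<open>B\<close> and \<open>Q\<close> across the inner product turns
      the series over \<open>e\<close> into the Parseval series of \<open>Q f\<close> against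
      \<open>Q (cadjoint B f)\<close>.\<close>
    show "((\<lambda>e. case (f, e) of (x, y) \<Rightarrow> a (y, x)) has_sum cinner (B (Q (Q f))) f) E" for f
    proof -
      have "cinner (B (Q e)) f = cinner e (Q (cadjoint B f))" for e
        by (simp add: cinner_cadjoint[OF B] positive_op_selfadjoint[OF Q])
      moreover have "cinner f (Q e) = cinner (Q f) e" for e
        by (simp add: positive_op_selfadjoint[OF Q])
      moreover have "cinner (Q f) (Q (cadjoint B f)) = cinner (B (Q (Q f))) f"
        by (simp add: cinner_cadjoint[OF B] positive_op_selfadjoint[OF Q])
      ultimately show ?thesis
        using onb_Parseval[OF E, of "Q f" "Q (cadjoint B f)"] by (simp add: a_def mult.commute)
    qed
  qed
  ultimately show thesis by (rule that)
qed

section \<open>Positive trace class operators and their trace functionals\<close>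

definition some_onb :: "'a::chilbert_space set"
  where "some_onb = (SOME E. is_onb E)"

text \<open>The working form of the trace class condition, stated in the very basis used by
  \<open>trace\<close>. That this choice is a basis is recorded here, because its existence comes
  from the witness inside \<open>trace_class\<close>.\<close>

definition positive_trace_class :: "('a::chilbert_space \<Rightarrow> 'a) \<Rightarrow> bool"
  where "positive_trace_class P \<longleftrightarrow> positive_op P \<and> is_onb (some_onb :: 'a set) \<and>
    (\<lambda>e. Re (cinner (P e) e)) summable_on some_onb"

lemma positive_op_square_cinner:
  assumes "positive_op Q" "Q \<circ> Q = P"
  shows "cinner (P e) e = complex_of_real ((norm (Q e))\<^sup>2)"
  using fun_cong[OF assms(2), of e] positive_op_selfadjoint[OF assms(1), of "Q e" e]
  by (auto simp: cinner_self)

text \<open>The modulus of \<open>P\<close> is \<open>P\<close> itself by uniqueness of square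
  roots; the double series with the identity as \<open>B\<close> then moves summability from the
  given basis to \<open>some_onb\<close>.\<close>

lemma positive_trace_classI:
  assumes P: "positive_op P" and tc: "trace_class P"
  shows "positive_trace_class P"
proof -
  obtain R E where R: "positive_op R" "R \<circ> R = cadjoint P \<circ> P"
    and E: "is_onb E" and sum: "(\<lambda>e. cinner (R e) e) summable_on E"
    using tc by (auto simp: trace_class_def)
  have "R = P"
    using R(2) by (intro positive_op_square_inject[OF P R(1)]) (simp only: cadjoint_positive_op[OF P])
  have onb: "is_onb (some_onb :: 'a set)" unfolding some_onb_def by (rule someI) (rule E)
  obtain Q where Q: "positive_op Q" "Q \<circ> Q = P" using positive_op_sqrt[OF P] by metis
  have "(\<lambda>e. (norm (Q e))\<^sup>2) summable_on E"
    using summable_on_Re[OF sum] by (simp add: \<open>R = P\<close> positive_op_square_cinner[OF Q])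
  then obtain t where "((\<lambda>f. cinner (Q (Q f)) f) has_sum t) some_onb"
    using trace_square_has_sum[OF E onb Q(1) bounded_clinear_id] by metis
  then have "(\<lambda>f. cinner (P f) f) summable_on some_onb"
    using fun_cong[OF Q(2)] by (auto intro!: has_sum_imp_summable)
  with P onb show ?thesis by (simp add: positive_trace_class_def summable_on_Re)
qed

text \<open>The double series with both bases equal to \<open>some_onb\<close>. The first series is
  the definition of the trace; in the second, symmetrised one, positivity and norm bounds are
  visible term by term.\<close>

lemma trace_functional_has_sum:
  assumes P: "positive_trace_class P" and B: "bounded_clinear B"
  shows "((\<lambda>e. cinner (B (P e)) e) has_sum trace_functional P B) some_onb"
    and "positive_op Q \<Longrightarrow> Q \<circ> Q = P \<Longrightarrow>
      ((\<lambda>e. cinner (B (Q e)) (Q e)) has_sum trace_functional P B) some_onb"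
proof -
  have *: "((\<lambda>e. cinner (B (P e)) e) has_sum trace_functional P B) some_onb \<and>
      ((\<lambda>e. cinner (B (Q e)) (Q e)) has_sum trace_functional P B) some_onb"
    if Q: "positive_op Q" "Q \<circ> Q = P" for Q
  proof -
    have onb: "is_onb (some_onb :: 'a set)" and "(\<lambda>e. (norm (Q e))\<^sup>2) summable_on some_onb"
      using P by (simp_all add: positive_trace_class_def positive_op_square_cinner[OF Q])
    then obtain t where t: "((\<lambda>e. cinner (B (Q e)) (Q e)) has_sum t) some_onb"
      "((\<lambda>f. cinner (B (Q (Q f))) f) has_sum t) some_onb"
      using trace_square_has_sum[OF onb onb Q(1) B] by metis
    then have "((\<lambda>f. cinner (B (P f)) f) has_sum t) some_onb"
      using fun_cong[OF Q(2)] by simp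
    moreover from infsumI[OF this] have "trace_functional P B = t"
      by (simp add: trace_functional_def trace_def some_onb_def)
    ultimately show ?thesis using t(1) by simp
  qed
  obtain Q' where "positive_op Q'" "Q' \<circ> Q' = P"
    using positive_op_sqrt P unfolding positive_trace_class_def by metis
  with * show "((\<lambda>e. cinner (B (P e)) e) has_sum trace_functional P B) some_onb" by blast
  show "((\<lambda>e. cinner (B (Q e)) (Q e)) has_sum trace_functional P B) some_onb"
    if "positive_op Q" "Q \<circ> Q = P"
    using *[OF that] by blast
qed

lemma positive_trace_class_mono:
  assumes P: "positive_trace_class P" and R: "positive_op R" and le: "op_le R P"
  shows "positive_trace_class R"
proof -
  have "(\<lambda>e. Re (cinner (R e) e)) summable_on some_onb"
    by (rule summable_on_comparison_test[of "\<lambda>e. Re (cinner (P e) e)"])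
      (use P in \<open>simp_all add: positive_trace_class_def op_leD[OF le] Re_cinner_positive[OF R]\<close>)
  with P R show ?thesis by (simp add: positive_trace_class_def)
qed

lemma positive_trace_class_diff:
  assumes P: "positive_trace_class P" and R: "positive_op R" and le: "op_le R P"
  shows "positive_trace_class (\<lambda>x. P x - R x)"
  using R le by (intro positive_trace_class_mono[OF P]) (simp_all add: op_le_def)

lemma positive_trace_class_scaleR:
  assumes P: "positive_trace_class P" and "0 \<le> c"
  shows "positive_trace_class (\<lambda>x. c *\<^sub>R P x)"
  using assms summable_on_cmult_right[of "\<lambda>e. Re (cinner (P e) e)" some_onb c]
  by (simp add: positive_trace_class_def positive_op_scaleR[unfolded scaleR_scaleC] scaleR_scaleC cinner_simps)

lemma trace_functional_scaleR:
  assumes P: "positive_trace_class P" and "0 \<le> c" and B: "bounded_clinear B"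
  shows "trace_functional (\<lambda>x. c *\<^sub>R P x) B = complex_of_real c * trace_functional P B"
proof (rule has_sum_unique)
  show "((\<lambda>e. cinner (B (c *\<^sub>R P e)) e) has_sum trace_functional (\<lambda>x. c *\<^sub>R P x) B) some_onb"
    by (intro trace_functional_has_sum positive_trace_class_scaleR assms)
  show "((\<lambda>e. cinner (B (c *\<^sub>R P e)) e) has_sum complex_of_real c * trace_functional P B) some_onb"
    using has_sum_cmult_right[OF trace_functional_has_sum(1)[OF P B], of "complex_of_real c"]
    by (simp add: scaleR_scaleC bounded_clinear_scaleC[OF B] cinner_simps)
qed

lemma trace_functional_diff_op:
  assumes P: "positive_trace_class P" and R: "positive_op R" and le: "op_le R P"
    and B: "bounded_clinear B"
  shows "trace_functional (\<lambda>x. P x - R x) B = trace_functional P B - trace_functional R B"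
proof -
  have "((\<lambda>e. cinner (B (P e)) e) has_sum
      trace_functional (\<lambda>x. P x - R x) B + trace_functional R B) some_onb"
    using has_sum_add[OF trace_functional_has_sum(1)[OF positive_trace_class_diff[OF P R le] B]
        trace_functional_has_sum(1)[OF positive_trace_class_mono[OF P R le] B]]
    by (simp add: bounded_clinear_simps[OF B] cinner_simps)
  from has_sum_unique[OF this trace_functional_has_sum(1)[OF P B]] show ?thesis
    by (simp add: algebra_simps)
qed

lemma positive_functional_trace_functional:
  assumes P: "positive_trace_class P"
  shows "positive_functional (trace_functional P)"
  unfolding positive_functional_def
proof (intro conjI allI impI)
  fix A B :: "'a \<Rightarrow> 'a" assume A: "bounded_clinear A" and B: "bounded_clinear B"
  show "trace_functional P (\<lambda>x. A x + B x) = trace_functional P A + trace_functional P B"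
  proof (rule has_sum_unique)
    show "((\<lambda>e. cinner (A (P e) + B (P e)) e) has_sum trace_functional P (\<lambda>x. A x + B x)) some_onb"
      by (rule trace_functional_has_sum[OF P bounded_clinear_add[OF A B]])
    show "((\<lambda>e. cinner (A (P e) + B (P e)) e) has_sum trace_functional P A + trace_functional P B) some_onb"
      using has_sum_add[OF trace_functional_has_sum(1)[OF P A] trace_functional_has_sum(1)[OF P B]]
      by (simp add: cinner_simps)
  qed
next
  fix c and A :: "'a \<Rightarrow> 'a" assume A: "bounded_clinear A"
  show "trace_functional P (\<lambda>x. c *\<^sub>C A x) = c * trace_functional P A"
  proof (rule has_sum_unique)
    show "((\<lambda>e. cinner (c *\<^sub>C A (P e)) e) has_sum trace_functional P (\<lambda>x. c *\<^sub>C A x)) some_onb"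
      by (rule trace_functional_has_sum[OF P bounded_clinear_const_scaleC[OF A]])
    show "((\<lambda>e. cinner (c *\<^sub>C A (P e)) e) has_sum c * trace_functional P A) some_onb"
      using has_sum_cmult_right[OF trace_functional_has_sum(1)[OF P A], of c] by (simp add: cinner_simps)
  qed
next
  fix A :: "'a \<Rightarrow> 'a" assume A: "bounded_clinear A"
  obtain Q where Q: "positive_op Q" "Q \<circ> Q = P"
    using positive_op_sqrt P unfolding positive_trace_class_def by metis
  \<comment> \<open>In the symmetrised series the terms are
    \<open>(norm (A (Q e)))\<^sup>2\<close>.\<close>
  have "((\<lambda>e. cinner ((cadjoint A \<circ> A) (Q e)) (Q e)) has_sum trace_functional P (cadjoint A \<circ> A)) some_onb"
    by (intro trace_functional_has_sum P Q bounded_clinear_comp bounded_clinear_cadjoint A)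
  then have s: "((\<lambda>e. complex_of_real ((norm (A (Q e)))\<^sup>2)) has_sum trace_functional P (cadjoint A \<circ> A)) some_onb"
    by (simp add: cinner_cadjoint_left[OF A] cinner_self)
  show "0 \<le> trace_functional P (cadjoint A \<circ> A)"
    using has_sum_nonneg[OF has_sum_Re[OF s]] has_sum_unique[OF has_sum_Im[OF s], of 0]
    by (simp add: less_eq_complex_def)
qed

lemma trace_functional_id:
  assumes "positive_trace_class P"
  shows "((\<lambda>e. cinner (P e) e) has_sum trace_functional P (\<lambda>x. x)) some_onb"
  using trace_functional_has_sum(1)[OF assms bounded_clinear_id] .

text \<open>Each term of the symmetrised series is at most \<open>K * (norm (Q e))\<^sup>2\<close>,
  and the squared norms sum to the trace of \<open>P\<close>.\<close>

lemma cmod_trace_functional_le: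
  assumes P: "positive_trace_class P" and B: "bounded_clinear B" and K: "\<And>x. norm (B x) \<le> K * norm x"
  shows "cmod (trace_functional P B) \<le> K * Re (trace_functional P (\<lambda>x. x))"
proof -
  obtain Q where Q: "positive_op Q" "Q \<circ> Q = P"
    using positive_op_sqrt P unfolding positive_trace_class_def by metis
  have "cmod (cinner (B (Q e)) (Q e)) \<le> K * Re (cinner (Q e) (Q e))" for e
    using norm_cinner_le[of "B (Q e)" "Q e"] mult_right_mono[OF K[of "Q e"], of "norm (Q e)"]
    by (simp add: Re_cinner_self power2_eq_square)
  then show ?thesis
    by (intro norm_infsum_le[OF trace_functional_has_sum(2)[OF P B Q]
          has_sum_cmult_right[OF has_sum_Re[OF trace_functional_has_sum(2)[OF P bounded_clinear_id Q]]]])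
qed

section \<open>Rank one operators\<close>

text \<open>Linear in \<open>x\<close> and conjugate linear in \<open>y\<close>, so that a linear
  functional composed with it is a sesquilinear form in the convention of
  \<open>cinner\<close>.\<close>

definition rank_one :: "'a::chilbert_space \<Rightarrow> 'a \<Rightarrow> 'a \<Rightarrow> 'a"
  where "rank_one x y z = cinner z y *\<^sub>C x"

lemma bounded_clinear_rank_one: "bounded_clinear (rank_one x y)"
proof (rule bounded_clinearI)
  show "norm (rank_one x y z) \<le> (norm y * norm x) * norm z" for z
    using mult_right_mono[OF norm_cinner_le[of z y], of "norm x"]
    by (simp add: rank_one_def norm_scaleC mult.commute mult.left_commute)
qed (simp_all add: rank_one_def cinner_simps complex_vector.scale_left_distrib)

lemma positive_op_rank_one: "positive_op (rank_one x x)"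
proof (rule positive_opI)
  show "cinner (rank_one x x y) z = cinner y (rank_one x x z)" for y z
    by (simp add: rank_one_def cinner_simps) (simp flip: cinner_commute)
  show "0 \<le> Re (cinner (rank_one x x z) z)" for z
    by (simp add: rank_one_def cinner_simps cinner_commute[of x z])
qed (rule bounded_clinear_rank_one)

text \<open>The trace series is the Parseval series of \<open>x\<close> against \<open>P y\<close>.
  Thus the functional determines its density through rank one operators.\<close>

lemma trace_functional_rank_one:
  assumes P: "positive_trace_class P"
  shows "trace_functional P (rank_one x y) = cinner (P x) y"
proof (rule has_sum_unique)
  show "((\<lambda>e. cinner (rank_one x y (P e)) e) has_sum trace_functional P (rank_one x y)) some_onb"
    by (rule trace_functional_has_sum[OF P bounded_clinear_rank_one])
  have P': "positive_op P" "is_onb (some_onb :: 'a set)" using P by (auto simp: positive_trace_class_def)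
  show "((\<lambda>e. cinner (rank_one x y (P e)) e) has_sum cinner (P x) y) some_onb"
    using onb_Parseval[OF P'(2), of x "P y"]
    by (simp add: rank_one_def cinner_simps positive_op_selfadjoint[OF P'(1)] mult.commute)
qed

section \<open>Positive functionals\<close>

lemma positive_functional_add:
  "positive_functional h \<Longrightarrow> bounded_clinear A \<Longrightarrow> bounded_clinear B \<Longrightarrow> h (\<lambda>x. A x + B x) = h A + h B"
  and positive_functional_scaleC:
  "positive_functional h \<Longrightarrow> bounded_clinear A \<Longrightarrow> h (\<lambda>x. c *\<^sub>C A x) = c * h A"
  by (simp_all add: positive_functional_def)

lemma positive_functional_zero: "positive_functional h \<Longrightarrow> h (\<lambda>x. 0) = 0"
  using positive_functional_scaleC[of h "\<lambda>x. 0" 0] by (simp add: bounded_clinear_zero)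

lemma positive_functional_diff:
  assumes "positive_functional h" "bounded_clinear A" "bounded_clinear B"
  shows "h (\<lambda>x. A x - B x) = h A - h B"
  using positive_functional_add[OF assms(1) bounded_clinear_diff[OF assms(2,3)] assms(3)] by simp

lemma positive_functional_sum:
  assumes h: "positive_functional h" and A: "\<And>i. i \<in> F \<Longrightarrow> bounded_clinear (A i)" and "finite F"
  shows "h (\<lambda>x. \<Sum>i\<in>F. A i x) = (\<Sum>i\<in>F. h (A i))"
  using \<open>finite F\<close> A
  by (induction F)
    (simp_all add: positive_functional_zero[OF h] positive_functional_add[OF h] bounded_clinear_sum)

text \<open>Positivity and order of functionals are defined by testing on
  \<open>cadjoint A \<circ> A\<close>; square roots turn this into testing on arbitrary positive
  operators.\<close>

lemma positive_op_eq_square: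
  assumes "positive_op P"
  obtains Q where "bounded_clinear Q" "P = cadjoint Q \<circ> Q"
  using positive_op_sqrt[OF assms] cadjoint_positive_op positive_opD(1) by metis

lemma positive_functional_nonneg: "positive_functional h \<Longrightarrow> positive_op P \<Longrightarrow> 0 \<le> h P"
  using positive_op_eq_square unfolding positive_functional_def by metis

lemma functional_leD: "functional_le h f \<Longrightarrow> positive_op P \<Longrightarrow> h P \<le> f P"
  using positive_op_eq_square unfolding functional_le_def by metis

lemma functional_le_trace_functional:
  assumes P: "positive_trace_class P" and R: "positive_op R" and le: "op_le R P"
  shows "functional_le (trace_functional R) (trace_functional P)"
  unfolding functional_le_def
proof (intro allI impI)
  fix A :: "'a \<Rightarrow> 'a" assume A: "bounded_clinear A"
  have "0 \<le> trace_functional (\<lambda>x. P x - R x) (cadjoint A \<circ> A)"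
    using positive_functional_trace_functional[OF positive_trace_class_diff[OF assms]] A
    by (simp add: positive_functional_def)
  then show "trace_functional R (cadjoint A \<circ> A) \<le> trace_functional P (cadjoint A \<circ> A)"
    using trace_functional_diff_op[OF assms bounded_clinear_comp[OF bounded_clinear_cadjoint[OF A] A]]
    by (simp add: less_eq_complex_def)
qed

lemma functional_le_scaled_trace_functional:
  assumes T: "positive_trace_class T" and "0 \<le> c" and R: "positive_op R" and le: "op_le R (\<lambda>x. c *\<^sub>R T x)"
  shows "functional_le (trace_functional R) (\<lambda>A. complex_of_real c * trace_functional T A)"
  using functional_le_trace_functional[OF positive_trace_class_scaleR[OF T \<open>0 \<le> c\<close>] R le]
  by (simp add: functional_le_def trace_functional_scaleR[OF T \<open>0 \<le> c\<close>]
      bounded_clinear_comp bounded_clinear_cadjoint)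

text \<open>From \<open>B\<^sup>* B \<le> K\<^sup>2\<close> it follows that \<open>h\<close>
  vanishes on all squares; polarising against the identity extends this to all of
  \<open>B(H)\<close>.\<close>

lemma positive_functional_eq_0:
  assumes h: "positive_functional h" and h0: "h (\<lambda>x. x) = 0" and A: "bounded_clinear A"
  shows "h A = 0"
proof -
  have sq: "h (cadjoint B \<circ> B) = 0" if B: "bounded_clinear B" for B
  proof -
    obtain K where K: "\<And>x. norm (B x) \<le> K * norm x" using bounded_clinear_bound[OF B] by metis
    have BB: "bounded_clinear (cadjoint B \<circ> B)"
      by (intro bounded_clinear_comp bounded_clinear_cadjoint B)
    have "positive_op (\<lambda>x. complex_of_real (K\<^sup>2) *\<^sub>C x - (cadjoint B \<circ> B) x)"
    proof (rule positive_opI)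
      show "0 \<le> Re (cinner (complex_of_real (K\<^sup>2) *\<^sub>C x - (cadjoint B \<circ> B) x) x)" for x
        using power_mono[OF K[of x], of 2]
        by (simp add: cinner_simps cinner_cadjoint_left[OF B] Re_cinner_self power_mult_distrib
            flip: of_real_power)
      show "cinner (complex_of_real (K\<^sup>2) *\<^sub>C x - (cadjoint B \<circ> B) x) y =
          cinner x (complex_of_real (K\<^sup>2) *\<^sub>C y - (cadjoint B \<circ> B) y)" for x y
        by (simp add: cinner_simps cinner_cadjoint_left[OF B] flip: cinner_cadjoint[OF B])
    qed (intro bounded_clinear_intros BB)
    from positive_functional_nonneg[OF h this] have "h (cadjoint B \<circ> B) \<le> 0"
      using positive_functional_diff[OF h bounded_clinear_const_scaleC[OF bounded_clinear_id] BB]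
        positive_functional_scaleC[OF h bounded_clinear_id] h0 by (simp add: less_eq_complex_def)
    moreover have "0 \<le> h (cadjoint B \<circ> B)" using h B by (simp add: positive_functional_def)
    ultimately show ?thesis by (rule antisym)
  qed
  \<comment> \<open>Expand the square of \<open>A + c\<close>: the two diagonal terms vanish under
    \<open>h\<close>, leaving the cross terms. The values \<open>1\<close> and \<open>\<i>\<close>
    of \<open>c\<close> then separate them.\<close>
  have pol: "c * h (cadjoint A) + cnj c * h A = 0" for c
  proof -
    define B where "B x = A x + c *\<^sub>C x" for x
    have B: "bounded_clinear B" unfolding B_def by (intro bounded_clinear_intros A)
    note A' = bounded_clinear_cadjoint[OF A]
    have "cadjoint B = (\<lambda>y. cadjoint A y + cnj c *\<^sub>C y)"
      by (rule cadjoint_eqI)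
        (simp_all add: A' bounded_clinear_add bounded_clinear_const_scaleC bounded_clinear_id B_def
          cinner_simps cinner_cadjoint[OF A])
    then have "cadjoint B \<circ> B = (\<lambda>x. ((cadjoint A \<circ> A) x + c *\<^sub>C cadjoint A x) +
        (cnj c *\<^sub>C A x + (cnj c * c) *\<^sub>C x))"
      by (auto simp: B_def bounded_clinear_simps[OF A'] complex_vector.scale_right_distrib)
    then have "h (cadjoint B \<circ> B) = (h (cadjoint A \<circ> A) + c * h (cadjoint A)) +
        (cnj c * h A + (cnj c * c) * h (\<lambda>x. x))"
      by (simp only: positive_functional_add[OF h] positive_functional_scaleC[OF h]
          bounded_clinear_intros A A')
    then show ?thesis using sq[OF A] sq[OF B] h0 by simp
  qed
  have "h (cadjoint A) + h A = 0" using pol[of 1] by simp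
  moreover have "\<i> * (h (cadjoint A) - h A) = 0" using pol[of \<i>] by (simp add: algebra_simps)
  ultimately show ?thesis by (simp add: complex_eq_iff)
qed

text \<open>Only the values of \<open>h\<close> on finite rank operators enter, so \<open>h\<close> need not be normal.\<close>

lemma positive_functional_density:
  assumes h: "positive_functional h" and P: "positive_trace_class P"
    and le: "functional_le h (trace_functional P)"
  obtains R where "positive_op R" "op_le R P" "\<And>x y. h (rank_one x y) = cinner (R x) y"
proof -
  have hP: "h (rank_one x x) \<le> cinner (P x) x" for x
    using functional_leD[OF le positive_op_rank_one] trace_functional_rank_one[OF P] by metis
  have pP: "positive_op P" using P by (simp add: positive_trace_class_def)
  obtain K where K: "0 < K" "\<And>y. Re (cinner (P y) y) \<le> K * (norm y)\<^sup>2"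
    using positive_op_bound[OF pP] by metis
  interpret q: positive_form "\<lambda>x y. h (rank_one x y)"
  proof
    show "h (rank_one (x + y) z) = h (rank_one x z) + h (rank_one y z)" for x y z
      using positive_functional_add[OF h bounded_clinear_rank_one[of x z] bounded_clinear_rank_one[of y z]]
      by (simp add: rank_one_def[abs_def] complex_vector.scale_right_distrib)
    show "h (rank_one x (y + z)) = h (rank_one x y) + h (rank_one x z)" for x y z
      using positive_functional_add[OF h bounded_clinear_rank_one[of x y] bounded_clinear_rank_one[of x z]]
      by (simp add: rank_one_def[abs_def] cinner_simps complex_vector.scale_left_distrib)
    show "h (rank_one (c *\<^sub>C x) y) = c * h (rank_one x y)" for c x y
      using positive_functional_scaleC[OF h bounded_clinear_rank_one[of x y], of c]
      by (simp add: rank_one_def[abs_def] mult.commute)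
    show "h (rank_one x (c *\<^sub>C y)) = cnj c * h (rank_one x y)" for c x y
      using positive_functional_scaleC[OF h bounded_clinear_rank_one[of x y], of "cnj c"]
      by (simp add: rank_one_def[abs_def] cinner_simps)
    show "0 \<le> h (rank_one x x)" for x
      by (rule positive_functional_nonneg[OF h positive_op_rank_one])
  qed
  have qK: "0 \<le> Re (h (rank_one x x)) \<and> Re (h (rank_one x x)) \<le> K * (norm x)\<^sup>2" for x
    using hP[of x] K(2)[of x] q.nonneg[of x] by (simp add: less_eq_complex_def)
  \<comment> \<open>Only the diagonal is controlled by \<open>P\<close>; Cauchy-Schwarz for the form
    of \<open>h\<close> transfers the bound off the diagonal.\<close>
  have "cmod (h (rank_one x y)) \<le> K * norm x * norm y" for x y
  proof (rule power2_le_imp_le)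
    have "(cmod (h (rank_one x y)))\<^sup>2 \<le> Re (h (rank_one x x)) * Re (h (rank_one y y))"
      by (rule q.Cauchy_Schwarz)
    also have "\<dots> \<le> (K * (norm x)\<^sup>2) * (K * (norm y)\<^sup>2)"
      using qK[of x] qK[of y] K(1) by (intro mult_mono) auto
    finally show "(cmod (h (rank_one x y)))\<^sup>2 \<le> (K * norm x * norm y)\<^sup>2"
      by (simp add: power_mult_distrib power2_eq_square mult_ac)
  qed (use K(1) in simp)
  then obtain R where R: "bounded_clinear R" "\<And>x y. h (rank_one x y) = cinner (R x) y"
    by (rule q.represented_by_operator) blast
  then have pR: "positive_op R" using q.nonneg by (simp add: positive_op_def)
  have "Re (cinner (R x) x) \<le> Re (cinner (P x) x)" for x
    using hP[of x] by (simp add: R(2) less_eq_complex_def)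
  then have "op_le R P" by (rule op_leI[OF pR pP])
  with pR show thesis using R(2) by (rule that)
qed

text \<open>This excludes singular functionals, which vanish on finite rank operators:
  \<open>h\<close> takes the same value at the identity and at the complement of a finite
  projection, where it is dominated by a tail of the trace of \<open>P\<close>.\<close>

lemma functional_le_trace_functional_eq_0:
  assumes h: "positive_functional h" and P: "positive_trace_class P"
    and le: "functional_le h (trace_functional P)" and h0: "\<And>x. h (rank_one x x) = 0"
    and A: "bounded_clinear A"
  shows "h A = 0"
proof -
  have onb: "is_onb (some_onb :: 'a set)" using P by (simp add: positive_trace_class_def)
  note f = positive_functional_trace_functional[OF P]
  have "Re (h (\<lambda>x. x)) \<le> \<epsilon>" if "0 < \<epsilon>" for \<epsilon>
  proof -
    have "((\<lambda>e. Re (cinner (P e) e)) has_sum Re (trace_functional P (\<lambda>x. x))) some_onb"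
      by (rule has_sum_Re[OF trace_functional_id[OF P]])
    from tendstoD[OF this[unfolded has_sum_def] \<open>0 < \<epsilon>\<close>] obtain F :: "'a set"
      where F: "finite F" "F \<subseteq> some_onb"
        "dist (\<Sum>e\<in>F. Re (cinner (P e) e)) (Re (trace_functional P (\<lambda>x. x))) < \<epsilon>"
      unfolding eventually_finite_subsets_at_top by blast
    have proj: "onb_proj F = (\<lambda>x. \<Sum>e\<in>F. rank_one e e x)"
      by (simp add: onb_proj_def[abs_def] rank_one_def)
    have projC: "bounded_clinear (onb_proj F)"
      unfolding proj by (intro bounded_clinear_intros bounded_clinear_rank_one)
    \<comment> \<open>Stated for any \<open>g\<close>, as it is applied both to \<open>h\<close> and
      to the trace functional.\<close>
    have split: "g (\<lambda>x. x - onb_proj F x) = g (\<lambda>x. x) - (\<Sum>e\<in>F. g (rank_one e e))"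
      if "positive_functional g" for g
      using positive_functional_diff[OF that bounded_clinear_id projC]
        positive_functional_sum[OF that bounded_clinear_rank_one F(1), of "\<lambda>e. e" "\<lambda>e. e"]
      by (simp add: proj)
    have "positive_op (\<lambda>x. x - onb_proj F x)"
    proof (rule positive_opI)
      show "cinner (x - onb_proj F x) y = cinner x (y - onb_proj F y)" for x y
        by (simp only: proj cinner.diff_left cinner.diff_right cinner.sum_left cinner.sum_right
            positive_op_selfadjoint[OF positive_op_rank_one])
      show "0 \<le> Re (cinner (x - onb_proj F x) x)" for x
        by (simp add: Re_cinner_minus_onb_proj[OF onb F(1,2)])
    qed (intro bounded_clinear_intros projC)
    from functional_leD[OF le this] split[OF h] split[OF f]
    have "h (\<lambda>x. x) \<le> trace_functional P (\<lambda>x. x) - (\<Sum>e\<in>F. cinner (P e) e)"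
      by (simp add: h0 trace_functional_rank_one[OF P])
    then have "Re (h (\<lambda>x. x)) \<le>
        Re (trace_functional P (\<lambda>x. x)) - (\<Sum>e\<in>F. Re (cinner (P e) e))"
      by (simp add: less_eq_complex_def)
    with F(3) show ?thesis unfolding dist_real_def by linarith
  qed
  then have "Re (h (\<lambda>x. x)) \<le> 0" by (meson dense_ge)
  moreover have "positive_op (\<lambda>x::'a. x)"
    by (rule positive_opI) (simp_all add: bounded_clinear_id Re_cinner_self)
  then have "0 \<le> h (\<lambda>x. x)" by (rule positive_functional_nonneg[OF h])
  ultimately have "h (\<lambda>x. x) = 0" by (simp add: less_eq_complex_def complex_eq_iff)
  from positive_functional_eq_0[OF h this A] show ?thesis .
qed

section \<open>Singularity and absolute continuity\<close>

lemma op_singular_iff_functional_singular: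
  assumes S: "positive_trace_class S" and T: "positive_trace_class T"
  shows "op_singular S T \<longleftrightarrow> functional_singular (trace_functional S) (trace_functional T)"
proof
  assume sing: "op_singular S T"
  show "functional_singular (trace_functional S) (trace_functional T)"
    unfolding functional_singular_def
  proof (intro allI impI)
    fix h and A :: "'a \<Rightarrow> 'a"
    assume h: "positive_functional h" and hS: "functional_le h (trace_functional S)"
      and hT: "functional_le h (trace_functional T)" and A: "bounded_clinear A"
    obtain R where R: "positive_op R" "op_le R S" "\<And>x y. h (rank_one x y) = cinner (R x) y"
      using positive_functional_density[OF h S hS] by metis
    \<comment> \<open>The density was obtained from the bound by \<open>S\<close>, but it encodes
      \<open>h\<close> itself, so testing the second bound on \<open>rank_one x x\<close> yields the
      comparison with \<open>T\<close>.\<close>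
    have "Re (cinner (R x) x) \<le> Re (cinner (T x) x)" for x
      using functional_leD[OF hT positive_op_rank_one, of x]
      by (simp add: R(3) trace_functional_rank_one[OF T] less_eq_complex_def)
    then have "op_le R T" using R(1) T by (intro op_leI) (simp_all add: positive_trace_class_def)
    with sing R(1,2) have "R = (\<lambda>x. 0)" by (simp add: op_singular_def)
    then have "h (rank_one x x) = 0" for x by (simp add: R(3) cinner_simps)
    from functional_le_trace_functional_eq_0[OF h S hS this A] show "h A = 0" .
  qed
next
  assume sing: "functional_singular (trace_functional S) (trace_functional T)"
  show "op_singular S T"
    unfolding op_singular_def
  proof (intro allI impI)
    fix R :: "'a \<Rightarrow> 'a"
    assume R: "positive_op R" and RS: "op_le R S" and RT: "op_le R T"
    note R' = positive_trace_class_mono[OF S R RS]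
    have "trace_functional R (rank_one x x) = 0" for x
      using sing positive_functional_trace_functional[OF R'] functional_le_trace_functional[OF S R RS]
        functional_le_trace_functional[OF T R RT] bounded_clinear_rank_one
      unfolding functional_singular_def by metis
    then have "Re (cinner (R x) x) = 0" for x by (simp add: trace_functional_rank_one[OF R'])
    then show "R = (\<lambda>x. 0)" by (intro ext positive_op_cinner_eq_0[OF R])
  qed
qed

text \<open>First the traces converge; then the trace bound, applied to the positive difference of
  \<open>S\<close> and \<open>Sn n\<close>, gives convergence at every \<open>A\<close>.\<close>

lemma trace_functional_tendsto:
  fixes Sn :: "nat \<Rightarrow> 'a::chilbert_space \<Rightarrow> 'a"
  assumes S: "positive_trace_class S" and Sn: "\<And>n. positive_op (Sn n)" and le: "\<And>n. op_le (Sn n) S"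
    and lim: "\<And>x. (\<lambda>n. Sn n x) \<longlonglongrightarrow> S x" and A: "bounded_clinear A"
  shows "(\<lambda>n. trace_functional (Sn n) A) \<longlonglongrightarrow> trace_functional S A"
proof -
  obtain K where K: "\<And>x. norm (A x) \<le> K * norm x" using bounded_clinear_bound[OF A] by metis
  let ?tr = "\<lambda>P. Re (trace_functional P (\<lambda>x. x))"
  have tr: "((\<lambda>e. Re (cinner (P e) e)) has_sum ?tr P) some_onb" if "positive_trace_class P" for P :: "'a \<Rightarrow> 'a"
    by (rule has_sum_Re[OF trace_functional_id[OF that]])
  note Sn' = positive_trace_class_mono[OF S Sn le]
  have "(\<lambda>n. ?tr (Sn n)) \<longlonglongrightarrow> ?tr S"
  proof (rule order_tendstoI)
    fix a assume "?tr S < a"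
    moreover have "?tr (Sn n) \<le> ?tr S" for n
      by (rule has_sum_mono[OF tr[OF Sn'] tr[OF S]]) (rule op_leD[OF le])
    ultimately show "eventually (\<lambda>n. ?tr (Sn n) < a) sequentially"
      by (intro always_eventually allI) (rule le_less_trans)
  next
    fix a assume "a < ?tr S"
    \<comment> \<open>A finite part of the diagonal sum of \<open>S\<close> already exceeds
      \<open>a\<close>; its finitely many terms converge, and the full trace of \<open>Sn n\<close>
      dominates that part.\<close>
    from order_tendstoD(1)[OF tr[OF S, unfolded has_sum_def] this] obtain F :: "'a set"
      where F: "finite F" "F \<subseteq> some_onb" "a < (\<Sum>e\<in>F. Re (cinner (S e) e))"
      unfolding eventually_finite_subsets_at_top by blast
    have "(\<lambda>n. \<Sum>e\<in>F. Re (cinner (Sn n e) e)) \<longlonglongrightarrow> (\<Sum>e\<in>F. Re (cinner (S e) e))"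
      by (intro tendsto_sum tendsto_Re tendsto_cinner lim tendsto_const)
    from order_tendstoD(1)[OF this F(3)]
    show "eventually (\<lambda>n. a < ?tr (Sn n)) sequentially"
    proof (rule eventually_mono)
      fix n assume "a < (\<Sum>e\<in>F. Re (cinner (Sn n e) e))"
      also have "\<dots> \<le> ?tr (Sn n)"
        by (rule finite_sum_le_has_sum[OF tr[OF Sn'] F(1,2)]) (rule Re_cinner_positive[OF Sn])
      finally show "a < ?tr (Sn n)" .
    qed
  qed
  then have "(\<lambda>n. ?tr S - ?tr (Sn n)) \<longlonglongrightarrow> 0"
    using tendsto_diff[OF tendsto_const, of "\<lambda>n. ?tr (Sn n)" "?tr S" sequentially "?tr S"] by simp
  then have null: "(\<lambda>n. K * (?tr S - ?tr (Sn n))) \<longlonglongrightarrow> 0"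
    by (rule tendsto_mult_right_zero)
  have bound: "cmod (trace_functional S A - trace_functional (Sn n) A) \<le> K * (?tr S - ?tr (Sn n))" for n
    using cmod_trace_functional_le[OF positive_trace_class_diff[OF S Sn le] A K, of n]
    by (simp add: trace_functional_diff_op[OF S Sn le] A bounded_clinear_id)
  have "(\<lambda>n. trace_functional S A - trace_functional (Sn n) A) \<longlonglongrightarrow> 0"
    by (rule Lim_null_comparison[OF _ null]) (simp add: bound)
  from tendsto_diff[OF tendsto_const this, of "trace_functional S A"] show ?thesis by simp
qed

lemma op_abs_continuous_iff_almost_dominated:
  assumes S: "positive_trace_class S" and T: "positive_trace_class T"
  shows "op_abs_continuous S T \<longleftrightarrow> almost_dominated (trace_functional S) (trace_functional T)"
proof
  have pS: "positive_op S" and pT: "positive_op T" using S T by (auto simp: positive_trace_class_def)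
  assume "op_abs_continuous S T"
  then obtain Sn :: "nat \<Rightarrow> 'a \<Rightarrow> 'a" where Sn: "\<And>n. positive_op (Sn n)"
    and mono: "\<And>n. op_le (Sn n) (Sn (Suc n))"
    and "\<And>n. \<exists>c\<ge>0. op_le (Sn n) (\<lambda>x. c *\<^sub>R T x)" and lim: "\<And>x. (\<lambda>n. Sn n x) \<longlonglongrightarrow> S x"
    unfolding op_abs_continuous_def by blast
  then obtain c where c: "\<And>n. 0 \<le> c n" "\<And>n. op_le (Sn n) (\<lambda>x. c n *\<^sub>R T x)" by metis
  \<comment> \<open>\<open>almost_dominated\<close> asks for this bound explicitly, while for
    operators it follows from monotone convergence of the quadratic forms.\<close>
  have le: "op_le (Sn n) S" for n
  proof (rule op_leI[OF Sn pS])
    fix x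
    have "incseq (\<lambda>n. Re (cinner (Sn n x) x))" by (intro incseq_SucI op_leD[OF mono])
    moreover have "(\<lambda>n. Re (cinner (Sn n x) x)) \<longlonglongrightarrow> Re (cinner (S x) x)"
      by (intro tendsto_Re tendsto_cinner lim tendsto_const)
    ultimately show "Re (cinner (Sn n x) x) \<le> Re (cinner (S x) x)" by (rule incseq_le)
  qed
  note Sn' = positive_trace_class_mono[OF S Sn le]
  show "almost_dominated (trace_functional S) (trace_functional T)"
    unfolding almost_dominated_def
    by (intro exI[of _ "\<lambda>n. trace_functional (Sn n)"] exI[of _ c] conjI allI impI
        positive_functional_trace_functional[OF Sn'] c functional_le_trace_functional Sn' Sn mono S le
        functional_le_scaled_trace_functional[OF T] trace_functional_tendsto[OF S Sn le lim])
next
  have pS: "positive_op S" and pT: "positive_op T" using S T by (auto simp: positive_trace_class_def)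
  assume "almost_dominated (trace_functional S) (trace_functional T)"
  then obtain g c where g: "\<And>n::nat. positive_functional (g n)" and c: "\<And>n. (0::real) \<le> c n"
    and mono: "\<And>n. functional_le (g n) (g (Suc n))"
    and le: "\<And>n. functional_le (g n) (trace_functional S)"
    and dom: "\<And>n. functional_le (g n) (\<lambda>A. complex_of_real (c n) * trace_functional T A)"
    and lim: "\<And>A. bounded_clinear A \<Longrightarrow> (\<lambda>n. g n A) \<longlonglongrightarrow> trace_functional S A"
    unfolding almost_dominated_def by blast
  have "\<exists>R. positive_op R \<and> op_le R S \<and> (\<forall>x y. g n (rank_one x y) = cinner (R x) y)" for n
    using positive_functional_density[OF g S le, of n] by metis
  then obtain R where R: "\<And>n. positive_op (R n)" "\<And>n. op_le (R n) S"
    "\<And>n x y. g n (rank_one x y) = cinner (R n x) y" by metis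
  have "op_le (R n) (R (Suc n))" for n
    using functional_leD[OF mono positive_op_rank_one]
    by (intro op_leI R(1)) (simp add: R(3) less_eq_complex_def)
  moreover have "op_le (R n) (\<lambda>x. c n *\<^sub>R T x)" for n
    using functional_leD[OF dom positive_op_rank_one]
    by (intro op_leI R(1) positive_op_scaleR pT c)
      (simp add: R(3) less_eq_complex_def trace_functional_rank_one[OF T] scaleR_scaleC cinner_simps)
  moreover have "(\<lambda>n. R n x) \<longlonglongrightarrow> S x" for x
  proof -
    obtain K where K: "0 < K" "\<And>y. Re (cinner (S y) y) \<le> K * (norm y)\<^sup>2"
      using positive_op_bound[OF pS] by metis
    \<comment> \<open>The form of the positive operator \<open>S - R n\<close> is at most that of
      \<open>S\<close>, so one constant \<open>K\<close> works for all \<open>n\<close>.\<close>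
    have bound: "(norm (S x - R n x))\<^sup>2 \<le> K * (Re (cinner (S x) x) - Re (cinner (R n x) x))" for n
    proof -
      have "positive_op (\<lambda>x. S x - R n x)" using R(2) by (simp add: op_le_def)
      moreover have "Re (cinner (S y - R n y) y) \<le> K * (norm y)\<^sup>2" for y
        using K(2)[of y] Re_cinner_positive[OF R(1), of n y] by (simp add: cinner_simps)
      ultimately have "(norm (S x - R n x))\<^sup>2 \<le> K * Re (cinner (S x - R n x) x)"
        by (rule positive_op_norm_sq_le)
      then show ?thesis by (simp add: cinner_simps)
    qed
    have null: "(\<lambda>n. K * (Re (cinner (S x) x) - Re (cinner (R n x) x))) \<longlonglongrightarrow> 0"
    proof -
      \<comment> \<open>Pointwise convergence of the functionals, evaluated at
        \<open>rank_one x x\<close>.\<close>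
      have "(\<lambda>n. cinner (R n x) x) \<longlonglongrightarrow> cinner (S x) x"
        using lim[OF bounded_clinear_rank_one, of x x] by (simp add: R(3) trace_functional_rank_one[OF S])
      then have "(\<lambda>n. K * (Re (cinner (S x) x) - Re (cinner (R n x) x))) \<longlonglongrightarrow>
          K * (Re (cinner (S x) x) - Re (cinner (S x) x))"
        by (intro tendsto_mult_left tendsto_diff tendsto_const tendsto_Re)
      then show ?thesis by simp
    qed
    have "(\<lambda>n. (norm (S x - R n x))\<^sup>2) \<longlonglongrightarrow> 0"
      by (rule Lim_null_comparison[OF _ null]) (simp add: bound)
    then have "(\<lambda>n. S x - R n x) \<longlonglongrightarrow> 0"
      by (simp add: tendsto_norm_zero_iff)
    from tendsto_diff[OF tendsto_const this, of "S x"] show ?thesis by simp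
  qed
  ultimately show "op_abs_continuous S T"
    unfolding op_abs_continuous_def using R(1) c by (intro exI[of _ R]) blast
qed

theorem theorem1p3:
  fixes S T :: "'a::chilbert_space \<Rightarrow> 'a"
  assumes "positive_op S" and "trace_class S"
    and "positive_op T" and "trace_class T"
  shows "(op_singular S T \<longleftrightarrow>
           functional_singular (trace_functional S) (trace_functional T)) \<and>
         (op_abs_continuous S T \<longleftrightarrow>
           almost_dominated (trace_functional S) (trace_functional T))"
  using op_singular_iff_functional_singular op_abs_continuous_iff_almost_dominated
    positive_trace_classI assms by blast

end
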